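(* Let $r\ge3$, $m$, $k$, $\ell$ be integers with either $k=1$ and $2\le\ell\le m-2$, or $k\ge2$, $\ell\ge2$ and $k\ell\le m-1$. Let $T$ be an $r$-th power hypertree with $m$ edges that has exactly $k$ pendant paths of length $\ell$. Then $\rho(T)\ge\rho(S_{r,\ell}(m,k))$, with equality if and only if $T\cong S_{r,\ell}(m,k)$.
   Context: A hypergraph $G$ has a finite vertex set $V(G)$ and an edge set $E(G)$ whose members are subsets of $V(G)$ with at least two vertices; it is $r$-uniform if every edge has exactly $r$ vertices. $\delta_G(u)$ denotes the number of edges containing $u$. A loose path of length $p$ from $v_0$ to $v_p$ is an alternating sequence $(v_0,e_1,v_1,\dots,v_{p-1},e_p,v_p)$ of distinct vertices and distinct edges with $v_{i-1},v_i\in e_i$ and $e_i\cap e_j=\emptyset$ whenever $|i-j|>1$. $G$ is connected if any two vertices are joined by a loose path. A loose cycle of length $p$ is $(v_0,e_1,v_1,\dots,v_{p-1},e_p,v_0)$ with distinct vertices $v_0,\dots,v_{p-1}$, distinct edges, $v_{i-1},v_i\in e_i$ ($v_p=v_0$), and $e_i\cap e_j=\emptyset$ whenever $|i-j|>1$ and $\{i,j\}\ne\{1,p\}$. A hypertree is a connected hypergraph with no loose cycle. For connected $G$, $d_G(u,v)$ is the length of a shortest loose path from $u$ to $v$ ($d_G(u,u)=0$), $D(G)=(d_G(u,v))_{u,v}$ is the distance matrix, and $\rho(G)$ (distance spectral radius) is its largest eigenvalue. For $r\ge2$ and a tree $G$, the $r$-th power of $G$ is the $r$-uniform hypergraph with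 vertex set $V(G)\cup\bigcup_{e\in E(G)}V_e$ and edge set $\{e\cup V_e:e\in E(G)\}$, where the $V_e$ are pairwise disjoint sets of $r-2$ new vertices; an $r$-th power hypertree is the $r$-th power of some tree. A pendant path of length $\ell\ge1$ in $G$ at $v_{\ell+1}$ is a loose path $(v_1,e_1,v_2,\dots,v_\ell,e_\ell,v_{\ell+1})$ such that $\delta_G(v_{\ell+1})\ge2$, $\delta_G(v_1)=1$, $\delta_G(v_i)=2$ for $i=2,\dots,\ell$, and $\delta_G(v)=1$ for every $v\in e_i\setminus\{v_i,v_{i+1}\}$, $i=1,\dots,\ell$ (pendant paths are counted as edge sequences $(e_1,\dots,e_\ell)$, not distinguished by the choice of the degree-one vertex $v_1\in e_1$). A pendant edge at $v$ is an edge $e\ni v$ such that $\delta_G(v)\ge2$ and every vertex of $e$ other than $v$ has degree one. $S_{r,\ell}(m,k)$ denotes the $r$-uniform hypertree with $m$ edges consisting of $k$ pendant $r$-uniform loose paths of length $\ell$ and $m-k\ell$ pendant edges (of size $r$) sharing a common vertex (all these paths and edges pairwise meet only in that common vertex). *)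

theory Defs
  imports Complex_Main "Jordan_Normal_Form.Char_Poly"
begin

section \<open>Hypergraphs\<close>

record 'a hypergraph =
  verts :: "'a set"
  hedges :: "'a set set"

definition hypergraph :: "'a hypergraph \<Rightarrow> bool" where
  "hypergraph G \<longleftrightarrow> finite (verts G) \<and> (\<forall>e\<in>hedges G. e \<subseteq> verts G \<and> 2 \<le> card e)"

definition uniform :: "nat \<Rightarrow> 'a hypergraph \<Rightarrow> bool" where
  "uniform r G \<longleftrightarrow> (\<forall>e\<in>hedges G. card e = r)"

definition hdegree :: "'a hypergraph \<Rightarrow> 'a \<Rightarrow> nat" where
  "hdegree G u = card {e \<in> hedges G. u \<in> e}"

definition hiso :: "'a hypergraph \<Rightarrow> 'b hypergraph \<Rightarrow> bool" where
  "hiso G H \<longleftrightarrow> (\<exists>f. bij_betw f (verts G) (verts H) \<and> hedges H = (\<lambda>e. f ` e) ` hedges G)"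

text \<open>
  A loose path $(v_0,e_1,v_1,\dots,e_p,v_p)$ is given by the vertex list $[v_0,\dots,v_p]$ and the
  edge list $[e_1,\dots,e_p]$; thus the edge $e_{i+1}$ is \<open>es ! i\<close>. The length \<open>p = length es\<close> may be
  0, which yields distance 0 from a vertex to itself.
\<close>

definition loose_path :: "'a hypergraph \<Rightarrow> 'a list \<Rightarrow> 'a set list \<Rightarrow> bool" where
  "loose_path G vs es \<longleftrightarrow>
     length vs = Suc (length es) \<and> set vs \<subseteq> verts G \<and> set es \<subseteq> hedges G \<and>
     distinct vs \<and> distinct es \<and>
     (\<forall>i<length es. vs ! i \<in> es ! i \<and> vs ! Suc i \<in> es ! i) \<and>
     (\<forall>i<length es. \<forall>j<length es. Suc i < j \<longrightarrow> es ! i \<inter> es ! j = {})"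

definition loose_path_between :: "'a hypergraph \<Rightarrow> 'a \<Rightarrow> 'a \<Rightarrow> nat \<Rightarrow> bool" where
  "loose_path_between G u v p \<longleftrightarrow>
     (\<exists>vs es. loose_path G vs es \<and> length es = p \<and> hd vs = u \<and> last vs = v)"

definition hconnected :: "'a hypergraph \<Rightarrow> bool" where
  "hconnected G \<longleftrightarrow> (\<forall>u\<in>verts G. \<forall>v\<in>verts G. \<exists>p. loose_path_between G u v p)"

text \<open>
  A loose cycle $(v_0,e_1,v_1,\dots,v_{p-1},e_p,v_0)$ is given by $[v_0,\dots,v_{p-1}]$ and
  $[e_1,\dots,e_p]$. Its length \<open>p\<close> is at least 2, since otherwise every single edge would be a
  cycle; a cycle of length 2 consists of two edges sharing at least two vertices.
\<close>

definition loose_cycle :: "'a hypergraph \<Rightarrow> 'a list \<Rightarrow> 'a set list \<Rightarrow> bool" where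
  "loose_cycle G vs es \<longleftrightarrow>
     2 \<le> length es \<and> length vs = length es \<and> set vs \<subseteq> verts G \<and> set es \<subseteq> hedges G \<and>
     distinct vs \<and> distinct es \<and>
     (\<forall>i<length es. vs ! i \<in> es ! i \<and> vs ! (Suc i mod length es) \<in> es ! i) \<and>
     (\<forall>i<length es. \<forall>j<length es.
        Suc i < j \<and> \<not> (i = 0 \<and> j = length es - 1) \<longrightarrow> es ! i \<inter> es ! j = {})"

definition hypertree :: "'a hypergraph \<Rightarrow> bool" where
  "hypertree G \<longleftrightarrow> hypergraph G \<and> hconnected G \<and> (\<nexists>vs es. loose_cycle G vs es)"

text \<open>
  A 2-uniform hypergraph is a simple graph, and its loose paths and loose cycles are the usual
  paths and cycles, the disjointness conditions then being automatic.
\<close>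

definition tree :: "'a hypergraph \<Rightarrow> bool" where
  "tree G \<longleftrightarrow> hypertree G \<and> uniform 2 G"


section \<open>Distance spectral radius\<close>

definition hdist :: "'a hypergraph \<Rightarrow> 'a \<Rightarrow> 'a \<Rightarrow> nat" where
  "hdist G u v = (LEAST p. loose_path_between G u v p)"

definition distance_matrix :: "'a hypergraph \<Rightarrow> 'a \<Rightarrow> 'a \<Rightarrow> real" where
  "distance_matrix G u v = real (hdist G u v)"

text \<open>Eigenvalues of a matrix whose rows and columns are indexed by a finite set \<open>A\<close>.\<close>

definition eigenvalue_on :: "'a set \<Rightarrow> ('a \<Rightarrow> 'a \<Rightarrow> real) \<Rightarrow> real \<Rightarrow> bool" where
  "eigenvalue_on A M c \<longleftrightarrow>
     (\<exists>x. (\<exists>u\<in>A. x u \<noteq> 0) \<and> (\<forall>u\<in>A. (\<Sum>v\<in>A. M u v * x v) = c * x u))"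

lemma eigenvalue_on_iff_eigenvalue:
  assumes "distinct us" "set us = A"
  shows "eigenvalue_on A M c \<longleftrightarrow>
    eigenvalue (mat (length us) (length us) (\<lambda>(i, j). M (us ! i) (us ! j))) c"
proof -
  define n where "n = length us"
  define B where "B = mat n n (\<lambda>(i, j). M (us ! i) (us ! j))"
  have bij: "bij_betw (\<lambda>i. us ! i) {..<n} A"
    using assms by (auto simp: n_def intro: bij_betw_nth)
  have sum_A: "(\<Sum>v\<in>A. g v) = (\<Sum>i<n. g (us ! i))" for g :: "'a \<Rightarrow> real"
    using sum.reindex_bij_betw[OF bij, of g] by simp
  have ball_A: "(\<forall>u\<in>A. P u) \<longleftrightarrow> (\<forall>i<n. P (us ! i))" for P
    using all_set_conv_all_nth[of us P] assms(2) by (simp add: n_def)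
  have dim_B: "dim_row B = n"
    by (simp add: B_def)
  have eigen: "eigenvector B y c \<longleftrightarrow>
      dim_vec y = n \<and> (\<exists>i<n. y $ i \<noteq> 0) \<and>
      (\<forall>i<n. (\<Sum>j<n. M (us ! i) (us ! j) * y $ j) = c * y $ i)" for y
  proof (cases "dim_vec y = n")
    case True
    have "B *\<^sub>v y = c \<cdot>\<^sub>v y \<longleftrightarrow> (\<forall>i<n. (B *\<^sub>v y) $ i = (c \<cdot>\<^sub>v y) $ i)"
      unfolding vec_eq_iff using True by (simp add: B_def)
    also have "\<dots> \<longleftrightarrow> (\<forall>i<n. (\<Sum>j<n. M (us ! i) (us ! j) * y $ j) = c * y $ i)"
      using True by (simp add: B_def scalar_prod_def lessThan_atLeast0)
    finally have 1: "B *\<^sub>v y = c \<cdot>\<^sub>v y \<longleftrightarrow>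
      (\<forall>i<n. (\<Sum>j<n. M (us ! i) (us ! j) * y $ j) = c * y $ i)" .
    have 2: "y \<noteq> 0\<^sub>v n \<longleftrightarrow> (\<exists>i<n. y $ i \<noteq> 0)"
      unfolding vec_eq_iff using True by simp
    have 3: "y \<in> carrier_vec n"
      using True by (rule carrier_vecI)
    show ?thesis
      unfolding eigenvector_def dim_B 1 2 using 3 True by blast
  next
    case False
    then have "y \<notin> carrier_vec n"
      using carrier_vecD by blast
    then show ?thesis
      unfolding eigenvector_def dim_B using False by blast
  qed
  have "eigenvalue_on A M c \<longleftrightarrow> eigenvalue B c"
  proof
    assume "eigenvalue_on A M c"
    then obtain x where x: "\<exists>u\<in>A. x u \<noteq> 0" "\<forall>u\<in>A. (\<Sum>v\<in>A. M u v * x v) = c * x u"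
      unfolding eigenvalue_on_def by blast
    have "\<exists>i<n. x (us ! i) \<noteq> 0"
      using x(1) ball_A[of "\<lambda>u. x u = 0"] by blast
    moreover have "\<forall>i<n. (\<Sum>j<n. M (us ! i) (us ! j) * x (us ! j)) = c * x (us ! i)"
      using x(2) unfolding sum_A ball_A .
    ultimately have "eigenvector B (vec n (\<lambda>i. x (us ! i))) c"
      unfolding eigen by auto
    then show "eigenvalue B c"
      unfolding eigenvalue_def by blast
  next
    assume "eigenvalue B c"
    then obtain y where y: "\<exists>i<n. y $ i \<noteq> 0"
      "\<forall>i<n. (\<Sum>j<n. M (us ! i) (us ! j) * y $ j) = c * y $ i"
      unfolding eigenvalue_def eigen by blast
    define x where "x u = y $ inv_into {..<n} (\<lambda>i. us ! i) u" for u
    have x: "x (us ! i) = y $ i" if "i < n" for i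
      using that bij by (simp add: x_def bij_betw_def)
    have "\<exists>u\<in>A. x u \<noteq> 0"
      using y(1) x ball_A[of "\<lambda>u. x u = 0"] by auto
    moreover have "\<forall>u\<in>A. (\<Sum>v\<in>A. M u v * x v) = c * x u"
      unfolding sum_A ball_A using y(2) x by simp
    ultimately show "eigenvalue_on A M c"
      unfolding eigenvalue_on_def by blast
  qed
  then show ?thesis
    by (simp add: B_def n_def)
qed

definition distance_spectral_radius :: "'a hypergraph \<Rightarrow> real" where
  "distance_spectral_radius G = Max {c. eigenvalue_on (verts G) (distance_matrix G) c}"


section \<open>Power hypertrees and pendant paths\<close>

definition is_power :: "nat \<Rightarrow> 'a hypergraph \<Rightarrow> 'a hypergraph \<Rightarrow> bool" where
  "is_power r G H \<longleftrightarrow>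
     (\<exists>W. (\<forall>e\<in>hedges G. finite (W e) \<and> card (W e) = r - 2 \<and> W e \<inter> verts G = {}) \<and>
          (\<forall>e\<in>hedges G. \<forall>f\<in>hedges G. e \<noteq> f \<longrightarrow> W e \<inter> W f = {}) \<and>
          verts H = verts G \<union> (\<Union>e\<in>hedges G. W e) \<and>
          hedges H = (\<lambda>e. e \<union> W e) ` hedges G)"

definition power_hypertree :: "nat \<Rightarrow> 'a hypergraph \<Rightarrow> bool" where
  "power_hypertree r T \<longleftrightarrow> (\<exists>G. tree G \<and> is_power r G T)"

text \<open>The vertices $v_1,\dots,v_{\ell+1}$ of a pendant path are \<open>vs ! 0\<close>, ..., \<open>vs ! length es\<close>.\<close>

definition pendant_path :: "'a hypergraph \<Rightarrow> 'a list \<Rightarrow> 'a set list \<Rightarrow> bool" where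
  "pendant_path G vs es \<longleftrightarrow>
     loose_path G vs es \<and> 1 \<le> length es \<and>
     2 \<le> hdegree G (vs ! length es) \<and> hdegree G (vs ! 0) = 1 \<and>
     (\<forall>i\<in>{1..<length es}. hdegree G (vs ! i) = 2) \<and>
     (\<forall>i<length es. \<forall>v\<in>es ! i - {vs ! i, vs ! Suc i}. hdegree G v = 1)"

definition pendant_paths :: "'a hypergraph \<Rightarrow> nat \<Rightarrow> 'a set list set" where
  "pendant_paths G l = {es. length es = l \<and> (\<exists>vs. pendant_path G vs es)}"


section \<open>The hypertree \<open>S\<^bsub>r,l\<^esub>(m,k)\<close>\<close>

text \<open>
  The branches at the centre \<open>(0, 0, 0)\<close> are numbered by \<open>b\<close>: branches \<open>b < k\<close> are loose paths of
  length \<open>l\<close>, and the remaining \<open>m - k * l\<close> branches are single edges. The \<open>j\<close>-th edge (\<open>j \<ge> 1\<close>) of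
  branch \<open>b\<close>, counted from the centre, consists of \<open>r - 1\<close> vertices \<open>(b, j, 1)\<close>, ...,
  \<open>(b, j, r - 1)\<close> of its own together with the vertex that attaches it to the previous edge: the
  centre if \<open>j = 1\<close>, and \<open>(b, j - 1, 1)\<close> otherwise.
\<close>

definition S_attach :: "nat \<Rightarrow> nat \<Rightarrow> nat \<times> nat \<times> nat" where
  "S_attach b j = (if j = 1 then (0, 0, 0) else (b, j - 1, 1))"

definition S_own :: "nat \<Rightarrow> nat \<Rightarrow> nat \<Rightarrow> (nat \<times> nat \<times> nat) set" where
  "S_own r b j = (\<lambda>t. (b, j, t)) ` {1..r - 1}"

definition S_index :: "nat \<Rightarrow> nat \<Rightarrow> nat \<Rightarrow> (nat \<times> nat) set" where
  "S_index l m k = {0..<k} \<times> {1..l} \<union> {k..<k + (m - k * l)} \<times> {1}"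

definition S_hypertree :: "nat \<Rightarrow> nat \<Rightarrow> nat \<Rightarrow> nat \<Rightarrow> (nat \<times> nat \<times> nat) hypergraph" where
  "S_hypertree r l m k =
     \<lparr> verts = insert (0, 0, 0) (\<Union>(b, j)\<in>S_index l m k. S_own r b j),
       hedges = (\<lambda>(b, j). insert (S_attach b j) (S_own r b j)) ` S_index l m k \<rparr>"

end

theory Submission
  imports Defs "HOL-Analysis.Function_Topology"
begin

text \<open>
  Let \<open>x\<close> be the positive Perron vector of the distance matrix of \<open>S = S\<^bsub>r,l\<^esub>(m,k)\<close>. By the Rayleigh
  principle it suffices to identify the vertices of \<open>T\<close> with those of \<open>S\<close> in such a way that the
  quadratic form of the distance matrix does not decrease at \<open>x\<close> when \<open>S\<close> is replaced by \<open>T\<close>, and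
  increases unless \<open>T\<close> is \<open>S\<close>.

  Root \<open>T\<close> at the end of one of its pendant paths. The \<open>k\<close> pendant paths are edge-disjoint, so \<open>T\<close>
  arises from \<open>S\<close> by reattaching branches: every pendant edge of \<open>S\<close> and every pendant path except
  the first may hang at a vertex of some pendant edge instead of the centre. If the branch of a vertex
  \<open>b\<close> hangs at \<open>p\<close> other than the centre, then the distance from \<open>b\<close> to \<open>p\<close> shrinks by 1, while those from \<open>b\<close>
  to the centre and to all vertices of the first pendant path grow by at least 1; no other distances
  shrink. Two applications of the triangle inequality show that \<open>x\<close> puts more weight on the centre and
  the first path than on \<open>p\<close>.
\<close>

section \<open>Distances as lengths of shortest walks\<close>

text \<open>The distances in \<open>T\<close> cannot be written down, because branches may hang on
  branches in any nested pattern. They are only bounded from below, by potentials that change by at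
  most 1 inside every edge; for the explicit hypertree \<open>S\<close>, upper bounds from concrete
  walks are enough. Since each loss is exactly 1 and a gain of 1 suffices to outweigh it, the
  potentials may be truncated, and the nesting never has to be analysed. The edges of
  \<open>T\<close> outside its \<open>k\<close> pendant paths need not be pendant: they merely take
  over the labels of the pendant edges of \<open>S\<close>, each owning its \<open>r - 1\<close>
  vertices away from the root. Two hypotheses shape the argument. A loose path with more than
  \<open>l\<close> but fewer than \<open>2 * l\<close> edges has overlapping pendant paths of length
  \<open>l\<close>, one from each end; the lower bound on \<open>m\<close> excludes this when there
  are at least two such paths. And \<open>r \<ge> 3\<close> provides two vertices besides the centre
  on an edge of the first path: their mutual distance 1 pays for the step from a hook to the centre
  when weights are compared.\<close>

definition hadj :: "'a hypergraph \<Rightarrow> ('a \<times> 'a) set" where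
  "hadj G = {(u, v). \<exists>e\<in>hedges G. u \<in> e \<and> v \<in> e}"

lemma hadj_relpow_sym: "(u, v) \<in> hadj G ^^ n \<Longrightarrow> (v, u) \<in> hadj G ^^ n"
proof (induction n arbitrary: v)
  case (Suc n)
  then obtain w where "(u, w) \<in> hadj G ^^ n" "(w, v) \<in> hadj G"
    by auto
  then have "(w, u) \<in> hadj G ^^ n" "(v, w) \<in> hadj G"
    using Suc.IH by (auto simp: hadj_def)
  then show ?case
    by (rule relpow_Suc_I2[rotated])
qed simp

lemma relpow_nth_diff:
  assumes "\<And>i. i < n \<Longrightarrow> (f i, f (Suc i)) \<in> R" "i \<le> j" "j \<le> n"
  shows "(f i, f j) \<in> R ^^ (j - i)"
proof -
  have "(f i, f (i + d)) \<in> R ^^ d" if "i + d \<le> n" for d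
    using that by (induction d) (use assms(1) in \<open>auto intro!: relcompI\<close>)
  from this[of "j - i"] show ?thesis
    using assms by simp
qed

lemma loose_path_imp_walk:
  assumes "loose_path_between G u v p"
  shows "(u, v) \<in> hadj G ^^ p"
proof -
  obtain vs es where P: "loose_path G vs es" "length es = p" "hd vs = u" "last vs = v"
    using assms by (auto simp: loose_path_between_def)
  then have len: "length vs = Suc p" and "\<And>i. i < p \<Longrightarrow> vs ! i \<in> es ! i \<and> vs ! Suc i \<in> es ! i"
    and "\<And>i. i < p \<Longrightarrow> es ! i \<in> hedges G"
    by (auto simp: loose_path_def)
  then have "\<And>i. i < p \<Longrightarrow> (vs ! i, vs ! Suc i) \<in> hadj G"
    unfolding hadj_def by blast
  from relpow_nth_diff[of p "(!) vs", OF this, of 0 p]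
  have "(vs ! 0, vs ! p) \<in> hadj G ^^ p"
    by simp
  moreover have "vs \<noteq> []"
    using len by auto
  ultimately show ?thesis
    using P(3,4) len by (simp add: hd_conv_nth last_conv_nth)
qed

text \<open>A shortest walk is a loose path, since any coincidence of vertices or edges that is
  forbidden in a loose path would allow a shortcut.\<close>

lemma walk_imp_loose_path:
  assumes sub: "\<And>e. e \<in> hedges G \<Longrightarrow> e \<subseteq> verts G" and u: "u \<in> verts G"
    and walk: "(u, v) \<in> hadj G ^^ n"
  shows "\<exists>p\<le>n. loose_path_between G u v p"
proof -
  define p where "p = (LEAST n. (u, v) \<in> hadj G ^^ n)"
  have p: "(u, v) \<in> hadj G ^^ p" and p_le: "p \<le> n"
    using walk by (auto simp: p_def intro: LeastI Least_le)
  have p_min: "p \<le> q" if "(u, v) \<in> hadj G ^^ q" for q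
    using that by (auto simp: p_def intro: Least_le)
  obtain f where f: "f 0 = u" "f p = v" "\<And>i. i < p \<Longrightarrow> (f i, f (Suc i)) \<in> hadj G"
    using p by (auto simp: relpow_fun_conv)
  then have "\<forall>i. \<exists>e. i < p \<longrightarrow> e \<in> hedges G \<and> f i \<in> e \<and> f (Suc i) \<in> e"
    by (fastforce simp: hadj_def)
  then obtain ed where ed: "\<And>i. i < p \<Longrightarrow> ed i \<in> hedges G \<and> f i \<in> ed i \<and> f (Suc i) \<in> ed i"
    by metis
  \<comment> \<open>Any jump from \<open>f i\<close> to \<open>f j\<close> can be spliced into the
    walk, so minimality of \<open>p\<close> bounds its length from below. The values
    \<open>d = 0, 1, 2\<close> exclude repeated vertices, repeated edges, and intersections of
    non-consecutive edges.\<close>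
  have short: "j - i \<le> d" if "(f i, f j) \<in> hadj G ^^ d" "i \<le> j" "j \<le> p" for i j d
  proof -
    have "(f 0, f i) \<in> hadj G ^^ i" "(f j, f p) \<in> hadj G ^^ (p - j)"
      using relpow_nth_diff[of p f "hadj G" 0 i] relpow_nth_diff[of p f "hadj G" j p] f that by auto
    then have "(u, v) \<in> hadj G ^^ (i + d + (p - j))"
      using that(1) f(1,2) by (auto simp: relpow_add simp del: Nat.add_diff_assoc)
    then show ?thesis
      using p_min that by fastforce
  qed
  have inj_f: "f i \<noteq> f j" if "i < j" "j \<le> p" for i j
    using short[of i j 0] that by auto
  have inj_ed: "ed i \<noteq> ed j" if "i < j" "j < p" for i j
  proof
    assume "ed i = ed j"
    then have "(f i, f (Suc j)) \<in> hadj G ^^ 1"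
      using ed[of i] ed[of j] that by (auto simp: hadj_def)
    then show False
      using short[of i "Suc j" 1] that by auto
  qed
  have disj: "ed i \<inter> ed j = {}" if "Suc i < j" "j < p" for i j
  proof (rule ccontr)
    assume "ed i \<inter> ed j \<noteq> {}"
    then obtain z where "z \<in> ed i" "z \<in> ed j"
      by auto
    then have "(f i, z) \<in> hadj G" "(z, f (Suc j)) \<in> hadj G"
      using ed[of i] ed[of j] that by (auto simp: hadj_def)
    then have "(f i, f (Suc j)) \<in> hadj G ^^ 2"
      by (auto simp: numeral_2_eq_2)
    then show False
      using short[of i "Suc j" 2] that by auto
  qed
  have "loose_path G (map f [0..<Suc p]) (map ed [0..<p])"
    unfolding loose_path_def
  proof (intro conjI allI impI)
    show "set (map f [0..<Suc p]) \<subseteq> verts G"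
    proof
      fix x assume "x \<in> set (map f [0..<Suc p])"
      then obtain i where i: "x = f i" "i \<le> p"
        by (force simp: less_Suc_eq_le)
      show "x \<in> verts G"
      proof (cases i)
        case 0
        then show ?thesis using i f u by simp
      next
        case (Suc j)
        then show ?thesis using i ed[of j] sub by auto
      qed
    qed
    show "distinct (map f [0..<Suc p])"
      unfolding distinct_map using inj_f
      by (metis distinct_upt inj_onI atLeastLessThan_iff less_Suc_eq_le linorder_neqE_nat set_upt)
    show "distinct (map ed [0..<p])"
      unfolding distinct_map using inj_ed
      by (metis distinct_upt inj_onI atLeastLessThan_iff linorder_neqE_nat set_upt)
  qed (use ed disj in \<open>auto simp: nth_append simp del: upt_Suc\<close>)
  moreover have "hd (map f [0..<Suc p]) = u" "last (map f [0..<Suc p]) = v"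
    using f by (simp_all add: hd_map last_map del: upt_Suc)
  ultimately have "loose_path_between G u v p"
    unfolding loose_path_between_def
    by (intro exI[of _ "map f [0..<Suc p]"] exI[of _ "map ed [0..<p]"]) simp
  then show ?thesis
    using p_le by blast
qed

lemma hdist_le_walk:
  assumes "\<And>e. e \<in> hedges G \<Longrightarrow> e \<subseteq> verts G" "u \<in> verts G" "(u, v) \<in> hadj G ^^ n"
  shows "hdist G u v \<le> n"
proof -
  obtain p where "p \<le> n" "loose_path_between G u v p"
    using walk_imp_loose_path[OF assms] by blast
  then show ?thesis
    unfolding hdist_def by (meson Least_le order_trans)
qed

lemma hdist_walk:
  assumes "hconnected G" "u \<in> verts G" "v \<in> verts G"
  shows "(u, v) \<in> hadj G ^^ hdist G u v"
  using assms unfolding hdist_def hconnected_def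
  by (intro loose_path_imp_walk) (metis LeastI)

lemma hdist_eq_0_iff:
  assumes "hconnected G" "u \<in> verts G" "v \<in> verts G" "\<And>e. e \<in> hedges G \<Longrightarrow> e \<subseteq> verts G"
  shows "hdist G u v = 0 \<longleftrightarrow> u = v"
  using hdist_walk[OF assms(1-3)] hdist_le_walk[OF assms(4,2), of v 0] by auto

lemma hdist_sym:
  assumes "hconnected G" "u \<in> verts G" "v \<in> verts G" "\<And>e. e \<in> hedges G \<Longrightarrow> e \<subseteq> verts G"
  shows "hdist G u v = hdist G v u"
proof (rule antisym)
  show "hdist G u v \<le> hdist G v u"
    using assms by (intro hdist_le_walk hadj_relpow_sym[OF hdist_walk]) auto
  show "hdist G v u \<le> hdist G u v"
    using assms by (intro hdist_le_walk hadj_relpow_sym[OF hdist_walk]) auto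
qed

lemma hdist_triangle:
  assumes "hconnected G" "u \<in> verts G" "v \<in> verts G" "w \<in> verts G"
    "\<And>e. e \<in> hedges G \<Longrightarrow> e \<subseteq> verts G"
  shows "hdist G u w \<le> hdist G u v + hdist G v w"
proof -
  have "(u, w) \<in> hadj G ^^ (hdist G u v + hdist G v w)"
    unfolding relpow_add using hdist_walk[OF assms(1)] assms by blast
  then show ?thesis
    using hdist_le_walk assms by metis
qed

text \<open>A potential that rises by at most 1 inside each edge rises by at most \<open>n\<close>
  along a walk of length \<open>n\<close>. Almost all lower bounds on distances below are certified
  by a suitable choice of \<open>h\<close>.\<close>

lemma hdist_ge_Lipschitz:
  fixes h :: "'a \<Rightarrow> int"
  assumes "hconnected G" "u \<in> verts G" "v \<in> verts G"
    and Lip: "\<And>e x y. e \<in> hedges G \<Longrightarrow> x \<in> e \<Longrightarrow> y \<in> e \<Longrightarrow> h y - h x \<le> 1"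
  shows "h v - h u \<le> int (hdist G u v)"
proof -
  have "h w - h u \<le> int n" if "(u, w) \<in> hadj G ^^ n" for n w
    using that
  proof (induction n arbitrary: w)
    case (Suc n)
    then obtain z where "(u, z) \<in> hadj G ^^ n" "(z, w) \<in> hadj G"
      by auto
    then show ?case
      using Suc.IH[of z] Lip by (force simp: hadj_def)
  qed simp
  then show ?thesis
    using hdist_walk[OF assms(1-3)] by blast
qed

lemma hconnected_walkI:
  assumes "\<And>e. e \<in> hedges G \<Longrightarrow> e \<subseteq> verts G" "\<And>v. v \<in> verts G \<Longrightarrow> (c, v) \<in> (hadj G)\<^sup>*"
  shows "hconnected G"
  unfolding hconnected_def
proof (intro ballI)
  fix u v assume "u \<in> verts G" "v \<in> verts G"
  then obtain m n where "(c, u) \<in> hadj G ^^ m" "(c, v) \<in> hadj G ^^ n"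
    using assms(2) by (meson rtrancl_imp_relpow)
  then have "(u, v) \<in> hadj G ^^ (m + n)"
    unfolding relpow_add by (blast intro: hadj_relpow_sym relcompI)
  then show "\<exists>p. loose_path_between G u v p"
    using walk_imp_loose_path[of G u v] assms(1) \<open>u \<in> verts G\<close> by blast
qed


section \<open>Invariance under isomorphism\<close>

lemma hiso_sym:
  assumes "hiso G H" "\<And>e. e \<in> hedges G \<Longrightarrow> e \<subseteq> verts G"
  shows "hiso H G"
proof -
  obtain f where f: "bij_betw f (verts G) (verts H)" "hedges H = (\<lambda>e. f ` e) ` hedges G"
    using assms by (auto simp: hiso_def)
  define g where "g = inv_into (verts G) f"
  have "bij_betw g (verts H) (verts G)"
    unfolding g_def using f by (simp add: bij_betw_inv_into)
  moreover have "g ` f ` e = e" if "e \<in> hedges G" for e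
    unfolding g_def using assms(2)[OF that] f(1) by (simp add: bij_betw_def inv_into_image_cancel)
  then have "hedges G = (\<lambda>e. g ` e) ` hedges H"
    unfolding f(2) image_image by (auto simp: image_iff)
  ultimately show ?thesis
    by (auto simp: hiso_def)
qed

lemma loose_path_between_image:
  assumes f: "inj_on f (verts G)" "f ` verts G \<subseteq> verts H" "(\<lambda>e. f ` e) ` hedges G \<subseteq> hedges H"
    and sub: "\<And>e. e \<in> hedges G \<Longrightarrow> e \<subseteq> verts G"
    and "loose_path_between G u v p"
  shows "loose_path_between H (f u) (f v) p"
proof -
  obtain vs es where P: "loose_path G vs es" "length es = p" "hd vs = u" "last vs = v"
    using assms(5) by (auto simp: loose_path_between_def)
  have P1: "length vs = Suc (length es)" "set vs \<subseteq> verts G" "set es \<subseteq> hedges G"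
    "distinct vs" "distinct es"
    "\<And>i. i < length es \<Longrightarrow> vs ! i \<in> es ! i \<and> vs ! Suc i \<in> es ! i"
    "\<And>i j. i < length es \<Longrightarrow> j < length es \<Longrightarrow> Suc i < j \<Longrightarrow> es ! i \<inter> es ! j = {}"
    using P(1) by (auto simp: loose_path_def)
  have es: "es ! i \<subseteq> verts G" if "i < length es" for i
    using that P1(3) sub by (meson nth_mem subsetD)
  have "loose_path H (map f vs) (map ((`) f) es)"
    unfolding loose_path_def
  proof (intro conjI allI impI)
    show "set (map f vs) \<subseteq> verts H" "set (map ((`) f) es) \<subseteq> hedges H"
      using P1(2,3) f(2,3) by (simp_all, blast+)
    show "distinct (map f vs)"
      using P1(2,4) f(1) by (simp add: distinct_map inj_on_subset)
    have "inj_on ((`) f) (set es)"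
      using P1(3) sub by (intro inj_onI) (metis f(1) inj_on_image_eq_iff subsetD)
    then show "distinct (map ((`) f) es)"
      using P1(5) by (simp add: distinct_map)
    show "map ((`) f) es ! i \<inter> map ((`) f) es ! j = {}"
      if "i < length (map ((`) f) es)" "j < length (map ((`) f) es)" "Suc i < j" for i j
    proof -
      have "f ` (es ! i \<inter> es ! j) = f ` (es ! i) \<inter> f ` (es ! j)"
        using es that by (intro inj_on_image_Int[OF f(1)]) auto
      then show ?thesis
        using P1(7)[of i j] that by simp
    qed
  qed (use P1 in \<open>auto\<close>)
  moreover have "vs \<noteq> []"
    using P1(1) by auto
  ultimately show ?thesis
    unfolding loose_path_between_def using P
    by (intro exI[of _ "map f vs"] exI[of _ "map ((`) f) es"]) (simp add: hd_map last_map)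
qed

lemma loose_path_between_iso:
  assumes f: "bij_betw f (verts G) (verts H)" "hedges H = (\<lambda>e. f ` e) ` hedges G"
    and sub: "\<And>e. e \<in> hedges G \<Longrightarrow> e \<subseteq> verts G"
    and uv: "u \<in> verts G" "v \<in> verts G"
  shows "loose_path_between H (f u) (f v) p \<longleftrightarrow> loose_path_between G u v p"
proof
  assume "loose_path_between G u v p"
  then show "loose_path_between H (f u) (f v) p"
    using loose_path_between_image[of f G H] f sub by (auto simp: bij_betw_def)
next
  assume *: "loose_path_between H (f u) (f v) p"
  define g where "g = inv_into (verts G) f"
  have g: "bij_betw g (verts H) (verts G)"
    unfolding g_def using f by (simp add: bij_betw_inv_into)
  have "g ` f ` e = e" if "e \<in> hedges G" for e
    unfolding g_def using sub[OF that] f(1) by (simp add: bij_betw_def inv_into_image_cancel)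
  then have "(\<lambda>e. g ` e) ` hedges H \<subseteq> hedges G"
    unfolding f(2) image_image by auto
  moreover have "e \<subseteq> verts H" if "e \<in> hedges H" for e
    using that f(1) sub unfolding f(2) bij_betw_def by blast
  ultimately have "loose_path_between G (g (f u)) (g (f v)) p"
    using * g by (intro loose_path_between_image[of g H G]) (auto simp: bij_betw_def)
  moreover have "g (f u) = u" "g (f v) = v"
    unfolding g_def using f(1) uv by (auto simp: bij_betw_def)
  ultimately show "loose_path_between G u v p"
    by simp
qed

lemma hiso_hconnected:
  assumes "hiso G H" "\<And>e. e \<in> hedges G \<Longrightarrow> e \<subseteq> verts G" "hconnected G"
  shows "hconnected H"
proof -
  obtain f where f: "bij_betw f (verts G) (verts H)" "hedges H = (\<lambda>e. f ` e) ` hedges G"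
    using assms by (auto simp: hiso_def)
  have "\<exists>p. loose_path_between H (f u) (f v) p" if "u \<in> verts G" "v \<in> verts G" for u v
    using loose_path_between_iso[OF f assms(2) that] assms(3) that by (auto simp: hconnected_def)
  moreover have "verts H = f ` verts G"
    using f(1) by (simp add: bij_betw_def)
  ultimately show ?thesis
    unfolding hconnected_def by simp
qed

lemma hiso_distance_spectral_radius:
  assumes "hiso G H" "\<And>e. e \<in> hedges G \<Longrightarrow> e \<subseteq> verts G"
  shows "distance_spectral_radius G = distance_spectral_radius H"
proof -
  obtain f where f: "bij_betw f (verts G) (verts H)" "hedges H = (\<lambda>e. f ` e) ` hedges G"
    using assms by (auto simp: hiso_def)
  have D: "distance_matrix H (f u) (f v) = distance_matrix G u v"
    if "u \<in> verts G" "v \<in> verts G" for u v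
    using loose_path_between_iso[OF f assms(2) that] by (simp add: distance_matrix_def hdist_def)
  have sum_H: "(\<Sum>v\<in>verts H. F v) = (\<Sum>v\<in>verts G. F (f v))" for F :: "_ \<Rightarrow> real"
    using sum.reindex_bij_betw[OF f(1), of F] by simp
  have VH: "verts H = f ` verts G"
    using f(1) by (simp add: bij_betw_def)
  have "eigenvalue_on (verts G) (distance_matrix G) c \<longleftrightarrow>
      eigenvalue_on (verts H) (distance_matrix H) c" for c
  proof
    assume "eigenvalue_on (verts H) (distance_matrix H) c"
    then obtain x where "\<exists>u\<in>verts H. x u \<noteq> 0"
      "\<forall>u\<in>verts H. (\<Sum>v\<in>verts H. distance_matrix H u v * x v) = c * x u"
      by (auto simp: eigenvalue_on_def)
    then have "\<exists>u\<in>verts G. (x \<circ> f) u \<noteq> 0"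
      "\<forall>u\<in>verts G. (\<Sum>v\<in>verts G. distance_matrix G u v * (x \<circ> f) v) = c * (x \<circ> f) u"
      unfolding sum_H by (auto simp: VH D cong: sum.cong)
    then show "eigenvalue_on (verts G) (distance_matrix G) c"
      unfolding eigenvalue_on_def by blast
  next
    assume "eigenvalue_on (verts G) (distance_matrix G) c"
    then obtain x where x: "\<exists>u\<in>verts G. x u \<noteq> 0"
      "\<forall>u\<in>verts G. (\<Sum>v\<in>verts G. distance_matrix G u v * x v) = c * x u"
      by (auto simp: eigenvalue_on_def)
    define y where "y = x \<circ> inv_into (verts G) f"
    have y: "y (f u) = x u" if "u \<in> verts G" for u
      using that f(1) by (simp add: y_def bij_betw_def)
    have "\<exists>u\<in>verts H. y u \<noteq> 0"
      using x(1) y by (auto simp: VH)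
    moreover have "\<forall>u\<in>verts H. (\<Sum>v\<in>verts H. distance_matrix H u v * y v) = c * y u"
      unfolding sum_H using x(2) by (auto simp: VH D y cong: sum.cong)
    ultimately show "eigenvalue_on (verts H) (distance_matrix H) c"
      unfolding eigenvalue_on_def by blast
  qed
  then show ?thesis
    by (simp add: distance_spectral_radius_def)
qed

section \<open>The largest eigenvalue of a symmetric matrix\<close>

definition qform :: "'a set \<Rightarrow> ('a \<Rightarrow> 'a \<Rightarrow> real) \<Rightarrow> ('a \<Rightarrow> real) \<Rightarrow> real" where
  "qform V M x = (\<Sum>u\<in>V. \<Sum>v\<in>V. M u v * x u * x v)"

definition sqnorm_on :: "'a set \<Rightarrow> ('a \<Rightarrow> real) \<Rightarrow> real" where
  "sqnorm_on V x = (\<Sum>u\<in>V. x u ^ 2)"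

text \<open>Eigenvalues are roots of the characteristic polynomial, which is monic and hence
  nonzero. Finiteness is what gives \<open>Max\<close> in the spectral radius its meaning.\<close>

lemma finite_eigenvalue_on:
  assumes "finite V"
  shows "finite {c. eigenvalue_on V M c}"
proof -
  obtain us where us: "distinct us" "set us = V"
    using finite_distinct_list[OF assms] by blast
  define B where "B = mat (length us) (length us) (\<lambda>(i, j). M (us ! i) (us ! j))"
  have B: "B \<in> carrier_mat (length us) (length us)"
    by (simp add: B_def)
  have "{c. eigenvalue_on V M c} = {c. poly (char_poly B) c = 0}"
    using eigenvalue_on_iff_eigenvalue[OF us] eigenvalue_root_char_poly[OF B] by (simp add: B_def)
  moreover have "char_poly B \<noteq> 0"
    using degree_monic_char_poly[OF B] by auto
  ultimately show ?thesis
    by (simp add: poly_roots_finite)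
qed

lemma sqnorm_on_pos: "finite V \<Longrightarrow> u \<in> V \<Longrightarrow> x u \<noteq> 0 \<Longrightarrow> 0 < sqnorm_on V x"
  unfolding sqnorm_on_def by (intro sum_pos2[of _ u]) auto

lemma qform_eigenvector:
  assumes "\<And>u. u \<in> V \<Longrightarrow> (\<Sum>v\<in>V. M u v * x v) = c * x u"
  shows "qform V M x = c * sqnorm_on V x"
proof -
  have "qform V M x = (\<Sum>u\<in>V. x u * (\<Sum>v\<in>V. M u v * x v))"
    unfolding qform_def by (simp add: sum_distrib_left mult_ac)
  also have "\<dots> = (\<Sum>u\<in>V. x u * (c * x u))"
    using assms by (intro sum.cong) auto
  finally show ?thesis
    by (simp add: sqnorm_on_def sum_distrib_left power2_eq_square mult_ac)
qed

lemma qform_attains_max: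
  assumes "finite V" "V \<noteq> {}"
  obtains x where "sqnorm_on V x = 1" "\<And>y. qform V M y \<le> qform V M x * sqnorm_on V y"
proof -
  \<comment> \<open>Coordinates outside \<open>V\<close> are pinned to 0, which neither the form nor
    the norm notices; the unit sphere then becomes a closed part of a compact product of
    intervals.\<close>
  define K :: "('a \<Rightarrow> real) set" where "K = PiE UNIV (\<lambda>i. if i \<in> V then {-1..1} else {0})"
  have "compactin (product_topology (\<lambda>_. euclidean) UNIV) K"
    unfolding K_def compactin_PiE by auto
  then have "compact K"
    by (simp add: euclidean_product_topology)
  define Sp where "Sp = K \<inter> sqnorm_on V -` {1}"
  have cont: "continuous_on UNIV (sqnorm_on V)" "continuous_on UNIV (qform V M)"
    unfolding sqnorm_on_def[abs_def] qform_def[abs_def] by (intro continuous_intros; simp)+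
  have "closed (sqnorm_on V -` {1})"
    using closed_vimage[OF _ cont(1), of "{1}"] by simp
  then have "compact Sp"
    unfolding Sp_def using \<open>compact K\<close> by (intro compact_Int_closed)
  have in_Sp: "(\<lambda>u. if u \<in> V then x u else 0) \<in> Sp" if x: "sqnorm_on V x = 1" for x
  proof -
    have "\<bar>x u\<bar> \<le> 1" if "u \<in> V" for u
    proof -
      have "x u ^ 2 \<le> sqnorm_on V x"
        unfolding sqnorm_on_def using that assms by (intro member_le_sum) auto
      then show ?thesis
        using x by (simp add: abs_square_le_1)
    qed
    moreover have "sqnorm_on V (\<lambda>u. if u \<in> V then x u else 0) = 1"
      using x unfolding sqnorm_on_def by (simp cong: sum.cong)
    ultimately show ?thesis
      unfolding Sp_def K_def by (auto simp: abs_le_iff)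
  qed
  obtain u where "u \<in> V"
    using assms by blast
  then have "sqnorm_on V (\<lambda>v. if v = u then 1 else 0) = 1"
    using assms by (simp add: sqnorm_on_def if_distrib[of "\<lambda>x. x ^ 2"] sum.delta cong: if_cong)
  then have "Sp \<noteq> {}"
    using in_Sp by blast
  from continuous_attains_sup[OF \<open>compact Sp\<close> this continuous_on_subset[OF cont(2)]]
  obtain x where x: "x \<in> Sp" "\<And>y. y \<in> Sp \<Longrightarrow> qform V M y \<le> qform V M x"
    by auto
  have "qform V M y \<le> qform V M x * sqnorm_on V y" for y
  proof (cases "\<exists>u\<in>V. y u \<noteq> 0")
    case True
    then have pos: "0 < sqnorm_on V y"
      using sqnorm_on_pos[OF assms(1)] by metis
    define s where "s = sqrt (sqnorm_on V y)"
    have s: "s > 0" "s ^ 2 = sqnorm_on V y"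
      using pos by (auto simp: s_def)
    have "sqnorm_on V (\<lambda>u. y u / s) = 1"
      using pos s unfolding sqnorm_on_def
      by (simp add: power_divide flip: sum_divide_distrib)
    from x(2)[OF in_Sp[OF this]]
    have "qform V M (\<lambda>u. y u / s) \<le> qform V M x"
      unfolding qform_def by (simp cong: sum.cong)
    moreover have "qform V M (\<lambda>u. y u / s) = qform V M y / s ^ 2"
      unfolding qform_def by (simp add: power2_eq_square sum_divide_distrib)
    ultimately show ?thesis
      using s pos by (simp add: divide_le_eq)
  qed (simp add: qform_def sqnorm_on_def)
  with x(1) that show ?thesis
    by (auto simp: Sp_def)
qed

text \<open>First-order condition at a maximizer: moving \<open>x\<close> by \<open>t\<close> along
  the coordinate \<open>u\<close> changes \<open>qform V M x - c * sqnorm_on V x\<close> by a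
  quadratic in \<open>t\<close> that is never positive, so its linear coefficient, twice the defect
  \<open>a\<close> of the eigenvalue equation, vanishes.\<close>

lemma qform_maximizer_eigenvector:
  assumes V: "finite V" and sym: "\<And>u v. u \<in> V \<Longrightarrow> v \<in> V \<Longrightarrow> M u v = M v u"
    and x: "qform V M x = c * sqnorm_on V x" and max: "\<And>y. qform V M y \<le> c * sqnorm_on V y"
    and u: "u \<in> V"
  shows "(\<Sum>v\<in>V. M u v * x v) = c * x u"
proof -
  define a where "a = (\<Sum>v\<in>V. M u v * x v) - c * x u"
  define d :: "'a \<Rightarrow> real" where "d v = (if v = u then 1 else 0)" for v
  have d: "(\<Sum>v\<in>V. f v * d v) = f u" for f :: "'a \<Rightarrow> real"
    using u V by (simp add: d_def if_distrib[of "(*) _"] cong: if_cong)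
  have "2 * t * a + t ^ 2 * (M u u - c) \<le> 0" for t
  proof -
    have "qform V M (\<lambda>v. x v + t * d v) =
       qform V M x + t * (\<Sum>w\<in>V. (\<Sum>v\<in>V. M w v * x v) * d w)
       + t * (\<Sum>w\<in>V. \<Sum>v\<in>V. (M w v * x w) * d v) + t ^ 2 * (\<Sum>w\<in>V. (\<Sum>v\<in>V. M w v * d v) * d w)"
      unfolding qform_def
      by (simp add: algebra_simps sum.distrib sum_distrib_left sum_distrib_right power2_eq_square)
    also have "\<dots> = qform V M x + t * (\<Sum>v\<in>V. M u v * x v) + t * (\<Sum>w\<in>V. M w u * x w) + t ^ 2 * M u u"
      by (simp only: d)
    also have "(\<Sum>w\<in>V. M w u * x w) = (\<Sum>v\<in>V. M u v * x v)"
      using sym u by (intro sum.cong) auto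
    finally have 1: "qform V M (\<lambda>v. x v + t * d v) =
      qform V M x + 2 * t * (\<Sum>v\<in>V. M u v * x v) + t ^ 2 * M u u"
      by simp
    have "sqnorm_on V (\<lambda>v. x v + t * d v) =
       sqnorm_on V x + 2 * t * (\<Sum>w\<in>V. x w * d w) + t ^ 2 * (\<Sum>w\<in>V. d w * d w)"
      unfolding sqnorm_on_def
      by (simp add: algebra_simps sum.distrib sum_distrib_left power2_eq_square)
    also have "\<dots> = sqnorm_on V x + 2 * t * x u + t ^ 2"
      by (simp only: d) (simp add: d_def)
    finally show ?thesis
      using max[of "\<lambda>v. x v + t * d v"] 1 x by (simp add: a_def algebra_simps)
  qed
  note ineq = this
  \<comment> \<open>The choice \<open>t = a / s\<close> turns the quadratic into
    \<open>a ^ 2\<close> times \<open>(2 * s + (M u u - c)) / s ^ 2\<close>; this \<open>s\<close>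
    is large enough to make that factor positive.\<close>
  define s where "s = 1 + \<bar>M u u - c\<bar>"
  have s: "s > 0" "s + s + (M u u - c) > 0"
    unfolding s_def by linarith+
  have "2 * (a / s) * a + (a / s) ^ 2 * (M u u - c) = a ^ 2 * (s + s + (M u u - c)) / s ^ 2"
    using s(1) by (simp add: field_simps power2_eq_square)
  with ineq[of "a / s"] s(1) have "a ^ 2 * (s + s + (M u u - c)) \<le> 0"
    by (simp add: divide_le_0_iff)
  moreover note s(2)
  ultimately have "a ^ 2 \<le> 0"
    by (simp add: mult_le_0_iff)
  then show ?thesis
    by (simp add: a_def)
qed

text \<open>Rayleigh principle: the maximum of the form on the unit sphere is an eigenvalue, and
  every eigenvalue is at most this maximum, as evaluating the form at an eigenvector shows.\<close>

lemma qform_le_Max_eigenvalue: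
  assumes V: "finite V" "V \<noteq> {}" and sym: "\<And>u v. u \<in> V \<Longrightarrow> v \<in> V \<Longrightarrow> M u v = M v u"
  shows "qform V M y \<le> Max {c. eigenvalue_on V M c} * sqnorm_on V y"
    and "\<exists>x. sqnorm_on V x = 1 \<and> qform V M x = Max {c. eigenvalue_on V M c}"
proof -
  obtain x where x: "sqnorm_on V x = 1" "\<And>y. qform V M y \<le> qform V M x * sqnorm_on V y"
    using qform_attains_max[OF V] by metis
  define c where "c = qform V M x"
  have "\<exists>u\<in>V. x u \<noteq> 0"
    using x(1) by (auto simp: sqnorm_on_def intro: ccontr)
  moreover have "\<forall>u\<in>V. (\<Sum>v\<in>V. M u v * x v) = c * x u"
    using qform_maximizer_eigenvector[of V M x c] V(1) sym x by (simp add: c_def)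
  ultimately have "eigenvalue_on V M c"
    unfolding eigenvalue_on_def by blast
  moreover have "c' \<le> c" if ev: "eigenvalue_on V M c'" for c'
  proof -
    obtain z u where z: "u \<in> V" "z u \<noteq> 0" "\<forall>u\<in>V. (\<Sum>v\<in>V. M u v * z v) = c' * z u"
      using ev unfolding eigenvalue_on_def by blast
    then have "c' * sqnorm_on V z \<le> c * sqnorm_on V z"
      using x(2)[of z] qform_eigenvector[of V M z c'] by (simp add: c_def)
    then show ?thesis
      using sqnorm_on_pos[of V u z] z V by simp
  qed
  ultimately have "Max {c. eigenvalue_on V M c} = c"
    using finite_eigenvalue_on[OF V(1)] by (intro Max_eqI) auto
  with x show "qform V M y \<le> Max {c. eigenvalue_on V M c} * sqnorm_on V y"
    "\<exists>x. sqnorm_on V x = 1 \<and> qform V M x = Max {c. eigenvalue_on V M c}"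
    by (auto simp: c_def)
qed

text \<open>Replacing a maximizer by its absolute values does not lower the form, so the result is
  again a maximizer and thus an eigenvector. A zero entry at \<open>u\<close> would make row
  \<open>u\<close> of the eigenvalue equation a vanishing sum of nonnegative terms; the positive
  off-diagonal entries would then force the whole vector to be zero.\<close>

lemma Max_eigenvalue_positive_eigenvector:
  assumes V: "finite V" "V \<noteq> {}" and sym: "\<And>u v. u \<in> V \<Longrightarrow> v \<in> V \<Longrightarrow> M u v = M v u"
    and nonneg: "\<And>u v. u \<in> V \<Longrightarrow> v \<in> V \<Longrightarrow> M u v \<ge> 0"
    and pos: "\<And>u v. u \<in> V \<Longrightarrow> v \<in> V \<Longrightarrow> u \<noteq> v \<Longrightarrow> M u v > 0"
  obtains x where "\<And>u. u \<in> V \<Longrightarrow> x u > 0"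
    "\<And>u. u \<in> V \<Longrightarrow> (\<Sum>v\<in>V. M u v * x v) = Max {c. eigenvalue_on V M c} * x u"
proof -
  define c where "c = Max {c. eigenvalue_on V M c}"
  have max: "qform V M y \<le> c * sqnorm_on V y" for y
    unfolding c_def by (rule qform_le_Max_eigenvalue(1)[OF V sym])
  obtain z where z: "sqnorm_on V z = 1" "qform V M z = c"
    using qform_le_Max_eigenvalue(2)[of V M, OF V sym] by (auto simp: c_def)
  define x where "x u = \<bar>z u\<bar>" for u
  have sx: "sqnorm_on V x = 1"
    using z(1) by (simp add: sqnorm_on_def x_def)
  have "qform V M z \<le> qform V M x"
    unfolding qform_def x_def
  proof (intro sum_mono)
    fix u v assume "u \<in> V" "v \<in> V"
    then show "M u v * z u * z v \<le> M u v * \<bar>z u\<bar> * \<bar>z v\<bar>"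
      using nonneg[of u v] by (simp add: mult.assoc mult_left_mono flip: abs_mult)
  qed
  then have "qform V M x = c * sqnorm_on V x"
    using max[of x] z sx by simp
  then have eig: "(\<Sum>v\<in>V. M u v * x v) = c * x u" if "u \<in> V" for u
    using qform_maximizer_eigenvector[of V M x c u] V(1) sym max that by blast
  have "x u > 0" if u: "u \<in> V" for u
  proof (rule ccontr)
    assume "\<not> x u > 0"
    then have xu: "x u = 0"
      by (simp add: x_def)
    then have "(\<Sum>v\<in>V. M u v * x v) = 0"
      using eig[OF u] by simp
    then have zero: "\<forall>v\<in>V. M u v * x v = 0"
      using V nonneg u by (subst (asm) sum_nonneg_eq_0_iff) (auto simp: x_def)
    have "x v = 0" if "v \<in> V" for v
      using zero that pos[OF u that] xu by (cases "u = v") auto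
    then show False
      using sx by (simp add: sqnorm_on_def)
  qed
  with eig that show ?thesis
    unfolding c_def by blast
qed

text \<open>
  The comparison principle: compared with \<open>D'\<close>, the matrix \<open>D\<close> may lose 1 on each pair
  \<open>(b, p b)\<close>, \<open>b \<in> B\<close>, but it gains 1 on each pair \<open>(a, b)\<close>, \<open>a \<in> A\<close>, and the Perron vector of \<open>D'\<close>
  puts more weight on \<open>A\<close> than on \<open>p b\<close>.
\<close>

lemma Max_eigenvalue_less:
  assumes V: "finite V" and sym: "\<And>u v. u \<in> V \<Longrightarrow> v \<in> V \<Longrightarrow> D u v = D v u"
    and x: "\<And>u. u \<in> V \<Longrightarrow> x u > 0" "\<And>u. u \<in> V \<Longrightarrow> (\<Sum>v\<in>V. D' u v * x v) = c * x u"
    and sub: "A \<subseteq> V" "B \<subseteq> V" "p ` B \<subseteq> V" and "B \<noteq> {}"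
    and diff: "\<And>u v. u \<in> V \<Longrightarrow> v \<in> V \<Longrightarrow>
      D' u v + of_bool (u \<in> A \<and> v \<in> B) + of_bool (v \<in> A \<and> u \<in> B)
        - of_bool (v \<in> B \<and> u = p v) - of_bool (u \<in> B \<and> v = p u) \<le> D u v"
    and weight: "\<And>b. b \<in> B \<Longrightarrow> x (p b) < (\<Sum>a\<in>A. x a)"
  shows "c < Max {c. eigenvalue_on V D c}"
proof -
  \<comment> \<open>\<open>f\<close> and \<open>g\<close> record one orientation of the gained and
    lost pairs and their transposes the other, so the form grows by at least twice
    \<open>qform V f x - qform V g x\<close>.\<close>
  define f g where "f u v = (of_bool (u \<in> A \<and> v \<in> B) :: real)"
    and "g u v = (of_bool (v \<in> B \<and> u = p v) :: real)" for u v
  have F: "qform V f x = (\<Sum>v\<in>B. x v * (\<Sum>a\<in>A. x a))"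
  proof -
    have "qform V f x = (\<Sum>v\<in>V. \<Sum>u\<in>V. f u v * x u * x v)"
      unfolding qform_def by (rule sum.swap)
    also have "\<dots> = (\<Sum>v\<in>V. if v \<in> B then x v * (\<Sum>a\<in>A. x a) else 0)"
    proof (rule sum.cong)
      fix v
      have "(\<Sum>u\<in>V. if u \<in> A then x v * x u else 0) = (\<Sum>u\<in>A. x v * x u)"
        using V sub(1) by (subst sum.inter_restrict[symmetric]) (auto simp: Int_absorb1)
      moreover have "(\<Sum>u\<in>V. f u v * x u * x v) = (\<Sum>u\<in>V. if u \<in> A then x v * x u else 0)" if "v \<in> B"
        using that by (intro sum.cong) (auto simp: f_def)
      ultimately show "(\<Sum>u\<in>V. f u v * x u * x v) = (if v \<in> B then x v * (\<Sum>a\<in>A. x a) else 0)"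
        by (simp add: f_def sum_distrib_left)
    qed simp
    also have "\<dots> = (\<Sum>v\<in>B. x v * (\<Sum>a\<in>A. x a))"
      using V sub(2) by (subst sum.inter_restrict[symmetric]) (auto simp: Int_absorb1)
    finally show ?thesis .
  qed
  have Gq: "qform V g x = (\<Sum>v\<in>B. x v * x (p v))"
  proof -
    have "qform V g x = (\<Sum>v\<in>V. \<Sum>u\<in>V. g u v * x u * x v)"
      unfolding qform_def by (rule sum.swap)
    also have "\<dots> = (\<Sum>v\<in>V. if v \<in> B then x v * x (p v) else 0)"
    proof (rule sum.cong)
      fix v
      show "(\<Sum>u\<in>V. g u v * x u * x v) = (if v \<in> B then x v * x (p v) else 0)"
      proof (cases "v \<in> B")
        case True
        then have "(\<Sum>u\<in>V. g u v * x u * x v) = (\<Sum>u\<in>V. if u = p v then x u * x v else 0)"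
          by (intro sum.cong) (auto simp: g_def)
        also have "\<dots> = x (p v) * x v"
          using V sub(3) True by (subst sum.delta) auto
        finally show ?thesis
          using True by simp
      qed (simp add: g_def)
    qed simp
    also have "\<dots> = (\<Sum>v\<in>B. x v * x (p v))"
      using V sub(2) by (subst sum.inter_restrict[symmetric]) (auto simp: Int_absorb1)
    finally show ?thesis .
  qed
  have transpose: "qform V (\<lambda>u v. h v u) x = qform V h x" for h
    unfolding qform_def by (subst sum.swap) (simp add: mult_ac)
  have "qform V D' x + qform V f x + qform V (\<lambda>u v. f v u) x
      - qform V g x - qform V (\<lambda>u v. g v u) x
    = qform V (\<lambda>u v. D' u v + f u v + f v u - g u v - g v u) x"
    unfolding qform_def by (simp add: algebra_simps sum.distrib sum_subtractf)
  also have "\<dots> \<le> qform V D x"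
    unfolding qform_def
  proof (intro sum_mono)
    fix u v assume uv: "u \<in> V" "v \<in> V"
    then have "(D' u v + f u v + f v u - g u v - g v u) * (x u * x v) \<le> D u v * (x u * x v)"
      using diff[OF uv] x(1)[of u] x(1)[of v] by (intro mult_right_mono) (auto simp: f_def g_def)
    then show "(D' u v + f u v + f v u - g u v - g v u) * x u * x v \<le> D u v * x u * x v"
      by (simp add: mult.assoc)
  qed
  also have "\<dots> \<le> Max {c. eigenvalue_on V D c} * sqnorm_on V x"
    using sub(2) \<open>B \<noteq> {}\<close> by (intro qform_le_Max_eigenvalue V sym) auto
  finally have "c * sqnorm_on V x + (qform V f x - qform V g x) + (qform V f x - qform V g x)
      \<le> Max {c. eigenvalue_on V D c} * sqnorm_on V x"
    using qform_eigenvector[of V D' x c, OF x(2)] transpose[of f] transpose[of g] by simp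
  moreover have "qform V g x < qform V f x"
    unfolding F Gq
  proof (rule sum_strict_mono)
    show "finite B"
      using sub(2) V by (rule finite_subset)
    show "x v * x (p v) < x v * (\<Sum>a\<in>A. x a)" if "v \<in> B" for v
      using weight[OF that] x(1)[of v] that sub(2) by auto
  qed fact
  ultimately have "c * sqnorm_on V x < Max {c. eigenvalue_on V D c} * sqnorm_on V x"
    by linarith
  moreover obtain b where "b \<in> V"
    using sub(2) \<open>B \<noteq> {}\<close> by auto
  then have "0 < sqnorm_on V x"
    using x(1)[of b] V by (intro sqnorm_on_pos[of V b]) auto
  ultimately show ?thesis
    by simp
qed

section \<open>Reattaching the branches of \<open>S\<^bsub>r,l\<^esub>(m,k)\<close>\<close>

text \<open>The branch \<open>b\<close> hangs at the vertex \<open>\<alpha> b\<close> instead of the centre.\<close>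

definition attach :: "(nat \<Rightarrow> nat \<times> nat \<times> nat) \<Rightarrow> nat \<Rightarrow> nat \<Rightarrow> nat \<times> nat \<times> nat" where
  "attach \<alpha> b j = (if j = 1 then \<alpha> b else (b, j - 1, 1))"

text \<open>The vertex set is literally that of \<open>S\<close>, so both distance matrices share
  their index set and the Perron vector of \<open>S\<close> can be inserted unchanged into the form
  of the reattached hypergraph.\<close>

definition branch_hypergraph ::
    "nat \<Rightarrow> nat \<Rightarrow> nat \<Rightarrow> nat \<Rightarrow> (nat \<Rightarrow> nat \<times> nat \<times> nat) \<Rightarrow> (nat \<times> nat \<times> nat) hypergraph" where
  "branch_hypergraph r l m k \<alpha> =
     \<lparr> verts = verts (S_hypertree r l m k),
       hedges = (\<lambda>(b, j). insert (attach \<alpha> b j) (S_own r b j)) ` S_index l m k \<rparr>"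

text \<open>The possible hooks: the centre and the vertices owned by pendant edges of
  \<open>S\<close>. A hook at any other vertex would raise a degree inside one of the
  \<open>k\<close> pendant paths.\<close>

definition S_core :: "nat \<Rightarrow> nat \<Rightarrow> nat \<Rightarrow> nat \<Rightarrow> (nat \<times> nat \<times> nat) set" where
  "S_core r l m k = insert (0, 0, 0) ({k..<k + (m - k * l)} \<times> {1} \<times> {1..r - 1})"

lemma S_hypertree_eq_branch_hypergraph:
  assumes "\<And>b. b < k + (m - k * l) \<Longrightarrow> \<alpha> b = (0, 0, 0)"
  shows "branch_hypergraph r l m k \<alpha> = S_hypertree r l m k"
proof -
  have "(\<lambda>(b, j). insert (attach \<alpha> b j) (S_own r b j)) ` S_index l m k =
      (\<lambda>(b, j). insert (S_attach b j) (S_own r b j)) ` S_index l m k"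
    using assms by (intro image_cong) (auto simp: S_index_def attach_def S_attach_def)
  then show ?thesis
    by (simp add: branch_hypergraph_def S_hypertree_def)
qed

lemma S_index_iff:
  "(b, j) \<in> S_index l m k \<longleftrightarrow>
     b < k \<and> 1 \<le> j \<and> j \<le> l \<or> k \<le> b \<and> b < k + (m - k * l) \<and> j = 1"
  by (auto simp: S_index_def)

lemma S_verts_iff:
  "(b, j, t) \<in> verts (S_hypertree r l m k) \<longleftrightarrow>
     b = 0 \<and> j = 0 \<and> t = 0 \<or> (b, j) \<in> S_index l m k \<and> t \<in> {1..r - 1}"
  unfolding S_hypertree_def S_own_def by (auto, force+)

lemma finite_S_verts: "finite (verts (S_hypertree r l m k))"
  unfolding S_hypertree_def S_own_def S_index_def by auto

text \<open>A cyclic pattern of hooks would be cut off from the centre. Connectivity, assumed by the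
  lemmas that need it, therefore stands in for an acyclicity condition on
  \<open>\<alpha>\<close>.\<close>

locale branches =
  fixes r l m k :: nat and \<alpha> :: "nat \<Rightarrow> nat \<times> nat \<times> nat"
  assumes r: "r \<ge> 3" and l: "l \<ge> 1" and k: "k \<ge> 1"
    and core: "\<And>b. b < k + (m - k * l) \<Longrightarrow> \<alpha> b \<in> S_core r l m k"
    and zero: "\<alpha> 0 = (0, 0, 0)"
begin

abbreviation "T \<equiv> branch_hypergraph r l m k \<alpha>"
abbreviation "V \<equiv> verts (S_hypertree r l m k)"

lemma verts_T [simp]: "verts T = V"
  by (simp add: branch_hypergraph_def)

lemma core_subset: "S_core r l m k \<subseteq> V"
  by (auto simp: S_core_def S_verts_iff S_index_iff)

lemma own_in_V: "(b, j) \<in> S_index l m k \<Longrightarrow> S_own r b j \<subseteq> V"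
  by (auto simp: S_own_def S_verts_iff)

lemma S_index_less: "(b, j) \<in> S_index l m k \<Longrightarrow> b < k + (m - k * l) \<and> j \<ge> 1"
  by (auto simp: S_index_iff)

lemma attach_in_V: "(b, j) \<in> S_index l m k \<Longrightarrow> attach \<alpha> b j \<in> V"
  using core[of b] core_subset S_index_less[of b j] r
  by (auto simp: attach_def S_verts_iff S_index_iff)

lemma edge_subset: "e \<in> hedges T \<Longrightarrow> e \<subseteq> verts T"
  using own_in_V attach_in_V by (auto simp: branch_hypergraph_def)

lemma edgeE:
  assumes "e \<in> hedges T" "u \<in> e" "v \<in> e"
  obtains b j where "(b, j) \<in> S_index l m k"
    "u = attach \<alpha> b j \<or> (\<exists>t\<in>{1..r - 1}. u = (b, j, t))"
    "v = attach \<alpha> b j \<or> (\<exists>t\<in>{1..r - 1}. v = (b, j, t))"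
  using assms by (auto simp: branch_hypergraph_def S_own_def)

text \<open>Splits the test of a potential by the kinds of vertex pairs in an edge. As a hook is
  known only to lie in \<open>S_core\<close>, the assumption \<open>first\<close> offers that
  membership as its sole information about \<open>\<alpha> b\<close>.\<close>

lemma Lipschitz_bound:
  fixes h :: "nat \<times> nat \<times> nat \<Rightarrow> int"
  assumes conn: "hconnected T" and uv: "u \<in> V" "v \<in> V"
    and own: "\<And>b j s t. (b, j) \<in> S_index l m k \<Longrightarrow> s \<in> {1..r - 1} \<Longrightarrow> t \<in> {1..r - 1} \<Longrightarrow>
      h (b, j, s) - h (b, j, t) \<le> 1"
    and first: "\<And>b t. (b, 1) \<in> S_index l m k \<Longrightarrow> \<alpha> b \<in> S_core r l m k \<Longrightarrow> t \<in> {1..r - 1} \<Longrightarrow>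
      \<bar>h (\<alpha> b) - h (b, 1, t)\<bar> \<le> 1"
    and further: "\<And>b j t. b < k \<Longrightarrow> 2 \<le> j \<Longrightarrow> j \<le> l \<Longrightarrow> t \<in> {1..r - 1} \<Longrightarrow>
      \<bar>h (b, j - 1, 1) - h (b, j, t)\<bar> \<le> 1"
  shows "h v - h u \<le> int (hdist T u v)"
proof (rule hdist_ge_Lipschitz[OF conn])
  show "u \<in> verts T" "v \<in> verts T"
    using uv by auto
next
  fix e x y assume "e \<in> hedges T" "x \<in> e" "y \<in> e"
  then obtain b j where bj: "(b, j) \<in> S_index l m k"
    "x = attach \<alpha> b j \<or> (\<exists>t\<in>{1..r - 1}. x = (b, j, t))"
    "y = attach \<alpha> b j \<or> (\<exists>t\<in>{1..r - 1}. y = (b, j, t))"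
    by (rule edgeE)
  have "\<bar>h (attach \<alpha> b j) - h (b, j, t)\<bar> \<le> 1" if "t \<in> {1..r - 1}" for t
  proof (cases "j = 1")
    case True
    then show ?thesis
      using first[of b t] bj(1) core[of b] S_index_less[of b j] that by (simp add: attach_def)
  next
    case False
    then show ?thesis
      using further[of b j t] bj(1) that by (simp add: attach_def S_index_iff)
  qed
  then show "h y - h x \<le> 1"
    using bj(2,3) own[OF bj(1)] by (auto simp: abs_le_iff)
qed

end

section \<open>Walks in \<open>S\<close> and upper bounds for its distances\<close>

lemma S_edge_subset:
  assumes "e \<in> hedges (S_hypertree r l m k)" "r \<ge> 3"
  shows "e \<subseteq> verts (S_hypertree r l m k)"
proof -
  obtain b j where bj: "(b, j) \<in> S_index l m k" "e = insert (S_attach b j) (S_own r b j)"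
    using assms(1) by (auto simp: S_hypertree_def)
  then have "S_attach b j \<in> verts (S_hypertree r l m k)"
    using assms(2) by (simp add: S_attach_def S_verts_iff) (auto simp: S_index_iff)
  moreover have "S_own r b j \<subseteq> verts (S_hypertree r l m k)"
    using bj(1) by (auto simp: S_own_def S_verts_iff)
  ultimately show ?thesis
    using bj(2) by simp
qed

lemma S_edgeI:
  "(b, j) \<in> S_index l m k \<Longrightarrow> insert (S_attach b j) (S_own r b j) \<in> hedges (S_hypertree r l m k)"
  unfolding S_hypertree_def by (auto intro!: rev_image_eqI[of "(b, j)"])

lemma S_hadj_same:
  "(b, j) \<in> S_index l m k \<Longrightarrow> s \<in> {1..r - 1} \<Longrightarrow> t \<in> {1..r - 1} \<Longrightarrow>
    ((b, j, s), (b, j, t)) \<in> hadj (S_hypertree r l m k)"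
  unfolding hadj_def by (auto simp: S_own_def intro!: bexI[OF _ S_edgeI])

lemma S_hadj_next:
  "(b, Suc j) \<in> S_index l m k \<Longrightarrow> t \<in> {1..r - 1} \<Longrightarrow>
    ((if j = 0 then (0, 0, 0) else (b, j, 1)), (b, Suc j, t)) \<in> hadj (S_hypertree r l m k)"
  unfolding hadj_def by (auto simp: S_own_def S_attach_def intro!: bexI[OF _ S_edgeI])

text \<open>The starting vertex is the one that carries edge \<open>Suc j\<close> of the branch, so
  a single induction covers walks from the centre and walks from within a leg.\<close>

lemma S_walk:
  assumes "(b, j + Suc n) \<in> S_index l m k" "t \<in> {1..r - 1}" "r \<ge> 3"
  shows "((if j = 0 then (0, 0, 0) else (b, j, 1)), (b, j + Suc n, t))
    \<in> hadj (S_hypertree r l m k) ^^ Suc n"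
  using assms
proof (induction n arbitrary: t)
  case 0
  then show ?case
    using S_hadj_next[of b j] by simp
next
  case (Suc n)
  have "(b, j + Suc n) \<in> S_index l m k"
    using Suc.prems by (auto simp: S_index_iff)
  then have "((if j = 0 then (0, 0, 0) else (b, j, 1)), (b, j + Suc n, 1))
      \<in> hadj (S_hypertree r l m k) ^^ Suc n"
    using Suc by simp
  moreover have "((b, j + Suc n, 1), (b, j + Suc (Suc n), t)) \<in> hadj (S_hypertree r l m k)"
    using S_hadj_next[of b "j + Suc n"] Suc.prems by simp
  ultimately show ?case
    by (rule relpow_Suc_I)
qed

lemma S_walk_centre:
  assumes "(b, j, t) \<in> verts (S_hypertree r l m k)" "r \<ge> 3"
  shows "((0, 0, 0), (b, j, t)) \<in> hadj (S_hypertree r l m k) ^^ j"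
proof (cases j)
  case 0
  then show ?thesis
    using assms by (auto simp: S_verts_iff S_index_iff)
next
  case (Suc n)
  then show ?thesis
    using S_walk[of b 0 n l m k t r] assms by (simp add: S_verts_iff)
qed

lemma S_hconnected:
  assumes "r \<ge> 3"
  shows "hconnected (S_hypertree r l m k)"
proof (rule hconnected_walkI)
  fix v assume "v \<in> verts (S_hypertree r l m k)"
  then show "((0, 0, 0), v) \<in> (hadj (S_hypertree r l m k))\<^sup>*"
    using S_walk_centre[OF _ assms] by (cases v) (meson relpow_imp_rtrancl)
qed (rule S_edge_subset[OF _ assms])

lemma S_hdist_centre:
  assumes "(b, j, t) \<in> verts (S_hypertree r l m k)" "r \<ge> 3"
  shows "hdist (S_hypertree r l m k) (0, 0, 0) (b, j, t) \<le> j"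
  using S_walk_centre[OF assms] S_edge_subset[OF _ assms(2)]
  by (intro hdist_le_walk) (auto simp: S_verts_iff)

lemma S_hdist_le_sum:
  assumes "(b, j, t) \<in> verts (S_hypertree r l m k)" "(b', j', t') \<in> verts (S_hypertree r l m k)" "r \<ge> 3"
  shows "hdist (S_hypertree r l m k) (b, j, t) (b', j', t') \<le> j + j'"
proof -
  have "((b, j, t), (b', j', t')) \<in> hadj (S_hypertree r l m k) ^^ (j + j')"
    unfolding relpow_add
    using hadj_relpow_sym[OF S_walk_centre[OF assms(1,3)]] S_walk_centre[OF assms(2,3)] by blast
  then show ?thesis
    using S_edge_subset[OF _ assms(3)] assms by (intro hdist_le_walk) auto
qed

text \<open>Only the vertex with \<open>t = 1\<close> carries the next edge. From any other vertex
  of level \<open>j\<close> one extra step to \<open>(b, j, 1)\<close> is spent first; the case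
  \<open>j = j'\<close> allows for one step inside the common edge.\<close>

lemma S_hdist_same_branch:
  assumes u: "(b, j, t) \<in> verts (S_hypertree r l m k)" and v: "(b, j', t') \<in> verts (S_hypertree r l m k)"
    and "r \<ge> 3" "1 \<le> j" "j \<le> j'"
  shows "hdist (S_hypertree r l m k) (b, j, t) (b, j', t') \<le> j' - j + of_bool (j = j' \<or> t \<noteq> 1)"
proof -
  have idx: "(b, j) \<in> S_index l m k" "(b, j') \<in> S_index l m k" "t \<in> {1..r - 1}" "t' \<in> {1..r - 1}"
    using u v \<open>1 \<le> j\<close> \<open>j \<le> j'\<close> by (auto simp: S_verts_iff)
  have "((b, j, t), (b, j', t'))
    \<in> hadj (S_hypertree r l m k) ^^ (j' - j + of_bool (j = j' \<or> t \<noteq> 1))"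
  proof (cases "j = j'")
    case True
    then show ?thesis
      using S_hadj_same[OF idx(1,3,4)] by simp
  next
    case False
    then obtain n where n: "j' = j + Suc n"
      using \<open>j \<le> j'\<close> by (metis add_Suc_right le_neq_implies_less less_iff_Suc_add)
    have w: "((b, j, 1), (b, j', t')) \<in> hadj (S_hypertree r l m k) ^^ Suc n"
      using S_walk[of b j n l m k t' r] idx \<open>1 \<le> j\<close> \<open>r \<ge> 3\<close> n by simp
    have "((b, j, t), (b, j, 1)) \<in> hadj (S_hypertree r l m k)"
      using idx \<open>r \<ge> 3\<close> by (intro S_hadj_same) auto
    then have "((b, j, t), (b, j', t')) \<in> hadj (S_hypertree r l m k) ^^ Suc (Suc n)"
      using w by (rule relpow_Suc_I2)
    then show ?thesis
      using w n by (cases "t = 1") simp_all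
  qed
  then show ?thesis
    using S_edge_subset[OF _ \<open>r \<ge> 3\<close>] u by (intro hdist_le_walk) auto
qed


section \<open>Lower bounds for distances after reattaching\<close>

context branches
begin

definition gain_set :: "(nat \<times> nat \<times> nat) set" where
  "gain_set = {(b, j, t) \<in> V. b \<noteq> 0 \<and> \<alpha> b \<noteq> (0, 0, 0)}"

text \<open>The centre has branch number 0, so it belongs to this set and its weight counts in the
  comparison.\<close>

definition first_leg :: "(nat \<times> nat \<times> nat) set" where
  "first_leg = {(b, j, t) \<in> V. b = 0}"

definition hook :: "nat \<times> nat \<times> nat \<Rightarrow> nat \<times> nat \<times> nat" where
  "hook v = \<alpha> (fst v)"

lemma V_less: "(b, j, t) \<in> V \<Longrightarrow> b < k + (m - k * l)"
  using k by (auto simp: S_verts_iff S_index_iff)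

text \<open>The potential is a signed depth: negative along the first leg, positive on all other
  branches, and raised by 1 on branches hung off the centre. Such a branch hangs at a core vertex of
  level 1, whose potential is 1 or 2, while its own first edge has potential 2, so the raise is
  compatible with the hook.\<close>

lemma hdist_first_leg:
  assumes conn: "hconnected T" and uv: "(0, j, t) \<in> V" "(b', j', t') \<in> V" "b' \<noteq> 0"
  shows "j + j' + of_bool (\<alpha> b' \<noteq> (0, 0, 0)) \<le> hdist T (0, j, t) (b', j', t')"
proof -
  define h :: "nat \<times> nat \<times> nat \<Rightarrow> int" where
    "h = (\<lambda>(b, j, t). if b = 0 then - int j else int j + of_bool (\<alpha> b \<noteq> (0, 0, 0)))"
  have "h (b', j', t') - h (0, j, t) \<le> int (hdist T (0, j, t) (b', j', t'))"
  proof (rule Lipschitz_bound[OF conn uv(1,2)])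
    fix b t assume "(b, 1) \<in> S_index l m k" "\<alpha> b \<in> S_core r l m k"
    then show "\<bar>h (\<alpha> b) - h (b, 1, t)\<bar> \<le> 1"
      using zero k by (auto simp: h_def S_core_def)
  qed (auto simp: h_def)
  then show ?thesis
    using uv(3) by (auto simp: h_def split: if_splits)
qed

text \<open>The potential is a truncated distance from \<open>u\<close>: it is 1 on every other core
  vertex, however far away, and on a leg it starts from the value at the hook of that leg, which is
  0 exactly when the leg hangs at \<open>u\<close>.\<close>

lemma hdist_core_leg:
  assumes conn: "hconnected T" and uv: "u \<in> S_core r l m k" "(b', j', t') \<in> V"
    and b': "b' < k" "1 \<le> j'"
  shows "j' + of_bool (\<alpha> b' \<noteq> u) \<le> hdist T u (b', j', t')"
proof -
  define h :: "nat \<times> nat \<times> nat \<Rightarrow> int" where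
    "h = (\<lambda>(b, j, t). if (b, j, t) = u then 0 else if b < k \<and> 1 \<le> j then int j + of_bool (\<alpha> b \<noteq> u)
      else 1)"
  have own: "h (b, j, t) = int j + of_bool (\<alpha> b \<noteq> u)" if "b < k" "1 \<le> j" for b j t
    using that uv(1) by (auto simp: h_def S_core_def)
  have hcore: "h v = of_bool (v \<noteq> u)" if "v \<in> S_core r l m k" for v
    using that by (auto simp: h_def S_core_def)
  have "h (b', j', t') - h u \<le> int (hdist T u (b', j', t'))"
  proof (rule Lipschitz_bound[OF conn _ uv(2)])
    show "u \<in> V"
      using uv(1) core_subset by blast
  next
    fix b j s t assume *: "(b, j) \<in> S_index l m k" "s \<in> {1..r - 1}" "t \<in> {1..r - 1}"
    show "h (b, j, s) - h (b, j, t) \<le> 1"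
    proof (cases "b < k")
      case True
      then show ?thesis
        using own S_index_less[OF *(1)] by simp
    qed (simp add: h_def)
  next
    fix b t assume *: "(b, 1) \<in> S_index l m k" "\<alpha> b \<in> S_core r l m k"
    show "\<bar>h (\<alpha> b) - h (b, 1, t)\<bar> \<le> 1"
    proof (cases "b < k")
      case True
      then show ?thesis
        using own hcore[OF *(2)] by simp
    next
      case False
      then have "h (b, 1, t) = 0 \<or> h (b, 1, t) = 1"
        by (simp add: h_def)
      then show ?thesis
        using hcore[OF *(2)] by auto
    qed
  next
    fix b j t :: nat assume "b < k" "2 \<le> j"
    then show "\<bar>h (b, j - 1, 1) - h (b, j, t)\<bar> \<le> 1"
      using own by simp
  qed
  then show ?thesis
    using own[OF b', of t'] hcore[OF uv(1)] by (auto split: if_splits)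
qed

text \<open>All core vertices receive potential 0, so the bound holds regardless of where the two
  legs hang.\<close>

lemma hdist_legs:
  assumes conn: "hconnected T" and uv: "(b, j, t) \<in> V" "(b', j', t') \<in> V"
    and b: "b < k" "b' < k" "b \<noteq> b'"
  shows "j + j' \<le> hdist T (b, j, t) (b', j', t')"
proof -
  define h :: "nat \<times> nat \<times> nat \<Rightarrow> int" where
    "h = (\<lambda>(c, i, t). if c = b then - int i else if c < k then int i else 0)"
  have "h (b', j', t') - h (b, j, t) \<le> int (hdist T (b, j, t) (b', j', t'))"
  proof (rule Lipschitz_bound[OF conn uv(1,2)])
    fix c t assume "(c, 1) \<in> S_index l m k" "\<alpha> c \<in> S_core r l m k"
    then show "\<bar>h (\<alpha> c) - h (c, 1, t)\<bar> \<le> 1"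
      using b by (auto simp: h_def S_core_def)
  qed (auto simp: h_def)
  then show ?thesis
    using b by (auto simp: h_def)
qed

lemma hdist_same_leg:
  assumes conn: "hconnected T" and uv: "(b, j, t) \<in> V" "(b, j', t') \<in> V" and b: "b < k"
  shows "j' \<le> hdist T (b, j, t) (b, j', t') + j"
proof -
  define h :: "nat \<times> nat \<times> nat \<Rightarrow> int" where
    "h = (\<lambda>(c, i, t). if c = b then int i else 0)"
  have "h (b, j', t') - h (b, j, t) \<le> int (hdist T (b, j, t) (b, j', t'))"
  proof (rule Lipschitz_bound[OF conn uv(1,2)])
    fix c t assume "(c, 1) \<in> S_index l m k" "\<alpha> c \<in> S_core r l m k"
    then show "\<bar>h (\<alpha> c) - h (c, 1, t)\<bar> \<le> 1"
      using b by (auto simp: h_def S_core_def)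
  qed (auto simp: h_def)
  then show ?thesis
    by (simp add: h_def)
qed

text \<open>Because \<open>t \<noteq> 1\<close>, the next edge does not contain the starting vertex.
  Hence this vertex alone can be lowered to 0 while its level keeps the value 1, which yields the
  extra unit.\<close>

lemma hdist_same_leg_off_path:
  assumes conn: "hconnected T" and uv: "(b, j, t) \<in> V" "(b, j', t') \<in> V" and b: "b < k" 
    and t: "t \<noteq> 1" and j: "1 \<le> j" "j < j'"
  shows "j' + 1 \<le> hdist T (b, j, t) (b, j', t') + j"
proof -
  define h :: "nat \<times> nat \<times> nat \<Rightarrow> int" where
    "h = (\<lambda>(c, i, s). if (c, i, s) = (b, j, t) then 0 else if c = b \<and> j < i then int i - int j + 1 else 1)"
  have "h (b, j', t') - h (b, j, t) \<le> int (hdist T (b, j, t) (b, j', t'))"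
  proof (rule Lipschitz_bound[OF conn uv(1,2)])
    fix c t assume "(c, 1) \<in> S_index l m k" "\<alpha> c \<in> S_core r l m k"
    then show "\<bar>h (\<alpha> c) - h (c, 1, t)\<bar> \<le> 1"
      using b j by (auto simp: h_def S_core_def)
  qed (use t in \<open>auto simp: h_def\<close>)
  then show ?thesis
    using j by (auto simp: h_def)
qed

lemma hdist_core:
  assumes conn: "hconnected T" and uv: "(b, 1, t) \<in> V" "(b', 1, t') \<in> V"
    and b: "k \<le> b" "k \<le> b'" "b \<noteq> b'"
  shows "2 \<le> hdist T (b, 1, t) (b', 1, t') + of_bool (\<alpha> b' = (b, 1, t) \<or> \<alpha> b = (b', 1, t'))"
proof -
  define u v where "u = (b, 1::nat, t)" and "v = (b', 1::nat, t')"
  have uv': "u \<in> verts T" "v \<in> verts T" "u \<noteq> v"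
    using uv b by (auto simp: u_def v_def)
  have ne: "hdist T u v \<noteq> 0"
    using hdist_eq_0_iff[OF conn uv'(1,2)] edge_subset uv'(3) by blast
  have "\<alpha> b' = u \<or> \<alpha> b = v" if "hdist T u v = 1"
  proof -
    have "(u, v) \<in> hadj T"
      using hdist_walk[OF conn uv'(1,2)] that by simp
    then obtain e where "e \<in> hedges T" "u \<in> e" "v \<in> e"
      by (auto simp: hadj_def)
    then obtain c j where "(c, j) \<in> S_index l m k"
      "u = attach \<alpha> c j \<or> (\<exists>t\<in>{1..r - 1}. u = (c, j, t))"
      "v = attach \<alpha> c j \<or> (\<exists>t\<in>{1..r - 1}. v = (c, j, t))"
      by (rule edgeE)
    then show ?thesis
      using b by (auto simp: u_def v_def attach_def S_index_iff split: if_splits; metis Pair_inject)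
  qed
  then show ?thesis
    using ne unfolding u_def v_def by (cases "hdist T (b, 1, t) (b', 1, t') = 1") auto
qed

text \<open>Only pairs \<open>(v, hook v)\<close> become closer than they are in \<open>S\<^bsub>r,l\<^esub>(m,k)\<close>.\<close>

lemma hdist_diff:
  assumes conn: "hconnected T" and uv: "u \<in> V" "v \<in> V"
  shows "hdist (S_hypertree r l m k) u v + of_bool (u \<in> first_leg \<and> v \<in> gain_set)
      + of_bool (v \<in> first_leg \<and> u \<in> gain_set)
    \<le> hdist T u v + of_bool (v \<in> gain_set \<and> u = hook v) + of_bool (u \<in> gain_set \<and> v = hook u)"
    (is "?P u v")
proof -
  define S where "S = S_hypertree r l m k"
  note SV = S_edge_subset[OF _ r, of _ l m k] S_hconnected[OF r, of l m k]
  have P_sym: "?P u v \<longleftrightarrow> ?P v u" if "u \<in> V" "v \<in> V" for u v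
    using hdist_sym[OF conn, of u v] hdist_sym[OF SV(2), of u v] edge_subset SV(1) that
    by (simp add: add_ac)
  have P_le: "?P u v" if "u \<in> V" "v \<in> V" "hdist S u v \<le> hdist T u v"
    "u \<notin> first_leg \<or> v \<notin> gain_set" "v \<notin> first_leg \<or> u \<notin> gain_set" for u v
    using that by (auto simp: S_def)
  \<comment> \<open>By symmetry the branches may be ordered by number. Branch 0 is the first leg and
    legs precede pendant edges, so the first leg and the gaining vertices then occur in one order
    only.\<close>
  have main: "?P (b, j, t) (b', j', t')"
    if uv: "(b, j, t) \<in> V" "(b', j', t') \<in> V" and ord: "b < b' \<or> b = b' \<and> j \<le> j'"
    for b j t b' j' t'
  proof (cases "b = b'")
    case True
    have A: "hdist S (b, j, t) (b', j', t') \<le> hdist T (b, j, t) (b', j', t')"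
    proof (cases "(b, j, t) = (b', j', t')")
      case True
      have "hdist S (b, j, t) (b, j, t) = 0"
        using uv(1) hdist_eq_0_iff[OF SV(2)] SV(1) unfolding S_def by metis
      then show ?thesis
        using True by simp
    next
      case False
      then have ge1: "1 \<le> hdist T (b, j, t) (b', j', t')"
        using hdist_eq_0_iff[OF conn, of "(b, j, t)" "(b', j', t')"] edge_subset uv by fastforce
      have jj: "j \<le> j'"
        using ord True by auto
      show ?thesis
      proof (cases "j = 0")
        \<comment> \<open>Level 0 means the centre. Sharing the branch number 0 with the first leg,
          it forms pairs with that leg which count as pairs within one branch.\<close>
        case j0: True
        then have "b < k"
          using uv(1) k by (auto simp: S_verts_iff S_index_iff)
        then have "j' \<le> hdist T (b, j, t) (b', j', t') + j"
          using hdist_same_leg[OF conn, of b j t j' t'] uv True by simp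
        then show ?thesis
          using S_hdist_le_sum[OF uv r] j0 unfolding S_def by simp
      next
        case j0: False
        have le: "hdist S (b, j, t) (b', j', t') \<le> j' - j + of_bool (j = j' \<or> t \<noteq> 1)"
          using S_hdist_same_branch[of b j t r l m k j' t'] uv r jj j0 True unfolding S_def by simp
        show ?thesis
        proof (cases "j = j'")
          case True
          then show ?thesis
            using le ge1 by simp
        next
          case j: False
          then have "b < k"
            using uv jj j0 True by (auto simp: S_verts_iff S_index_iff)
          then have "j' - j + of_bool (t \<noteq> 1) \<le> hdist T (b, j, t) (b', j', t')"
            using hdist_same_leg[OF conn, of b j t j' t'] j j0 jj uv True
              hdist_same_leg_off_path[OF conn, of b j t j' t'] by (cases "t = 1") auto
          then show ?thesis
            using le j by simp
        qed
      qed
    qed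
    show ?thesis
      using A uv True by (intro P_le) (auto simp: first_leg_def gain_set_def)
  next
    case False
    then have bb: "b < b'"
      using ord by simp
    have le: "hdist S (b, j, t) (b', j', t') \<le> j + j'"
      using S_hdist_le_sum[OF uv r] by (simp add: S_def)
    show ?thesis
    proof (cases "b = 0")
      case True
      have "j + j' + of_bool (\<alpha> b' \<noteq> (0, 0, 0)) \<le> hdist T (b, j, t) (b', j', t')"
        using hdist_first_leg[OF conn, of j t b' j' t'] uv bb True by simp
      then show ?thesis
        using le True bb by (auto simp: S_def first_leg_def gain_set_def split: if_splits)
    next
      case b0: False
      have notA: "(b, j, t) \<notin> first_leg" "(b', j', t') \<notin> first_leg"
        using b0 bb by (auto simp: first_leg_def)
      have "b' \<noteq> 0" "b' < k + (m - k * l)"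
        using bb V_less uv by auto
      have idx: "(b, j) \<in> S_index l m k" "(b', j') \<in> S_index l m k"
        "t \<in> {1..r - 1}" "t' \<in> {1..r - 1}"
        using uv b0 bb by (auto simp: S_verts_iff)
      \<comment> \<open>Two legs never come closer. A leg and a pendant edge, or two pendant edges,
        lose 1 only at a vertex where one of them hangs, and such a pair consists of a gaining
        vertex and its hook.\<close>
      consider "b' < k" | "b < k" "k \<le> b'" | "k \<le> b"
        by linarith
      then show ?thesis
      proof cases
        case 1
        then have "j + j' \<le> hdist T (b, j, t) (b', j', t')"
          using hdist_legs[OF conn uv] bb by simp
        then show ?thesis
          using le uv notA by (intro P_le) auto
      next
        case 2
        then have "j' = 1" "1 \<le> j"
          using idx by (auto simp: S_index_iff)
        have "(b', j', t') \<in> S_core r l m k"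
          using 2 \<open>j' = 1\<close> \<open>b' < _\<close> idx by (auto simp: S_core_def)
        from hdist_core_leg[OF conn this uv(1) 2(1) \<open>1 \<le> j\<close>]
        have "j + of_bool (\<alpha> b \<noteq> (b', j', t')) \<le> hdist T (b, j, t) (b', j', t')"
          using hdist_sym[OF conn, of "(b, j, t)" "(b', j', t')"] edge_subset uv by simp
        moreover have "(b, j, t) \<in> gain_set" if "\<alpha> b = (b', j', t')"
          using that uv b0 \<open>b' \<noteq> 0\<close> by (auto simp: gain_set_def)
        ultimately show ?thesis
          using le notA \<open>j' = 1\<close>
          by (cases "\<alpha> b = (b', j', t')") (simp_all add: S_def hook_def)
      next
        case 3
        then have "j = 1" "j' = 1"
          using idx bb by (auto simp: S_index_iff)
        then have "2 \<le> hdist T (b, j, t) (b', j', t')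
            + of_bool (\<alpha> b' = (b, j, t) \<or> \<alpha> b = (b', j', t'))"
          using hdist_core[OF conn, of b t b' t'] uv 3 bb by simp
        moreover have "(b, j, t) \<in> gain_set" if "\<alpha> b = (b', j', t')"
          using that uv b0 \<open>b' \<noteq> 0\<close> by (auto simp: gain_set_def)
        moreover have "(b', j', t') \<in> gain_set" if "\<alpha> b' = (b, j, t)"
          using that uv b0 \<open>b' \<noteq> 0\<close> by (auto simp: gain_set_def)
        ultimately show ?thesis
          using le notA \<open>j = 1\<close> \<open>j' = 1\<close>
          by (cases "\<alpha> b = (b', j', t')"; cases "\<alpha> b' = (b, j, t)") (simp_all add: S_def hook_def)
      qed
    qed
  qed
  obtain b j t b' j' t' where eq: "u = (b, j, t)" "v = (b', j', t')"
    by (cases u, cases v) auto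
  consider "b < b' \<or> b = b' \<and> j \<le> j'" | "b' < b \<or> b' = b \<and> j' \<le> j"
    by linarith
  then show ?thesis
  proof cases
    case 1
    then show ?thesis
      using main uv unfolding eq by blast
  next
    case 2
    then have "?P v u"
      using main uv unfolding eq by blast
    then show ?thesis
      using P_sym uv by blast
  qed
qed

section \<open>The Perron vector of \<open>S\<close> and the strict comparison\<close>

text \<open>The triangle inequality through the centre, combined with that between two further vertices of
  an edge at the centre, bounds the Perron weight of any neighbour of the centre.\<close>

lemma S_Perron_weight:
  fixes x :: "nat \<times> nat \<times> nat \<Rightarrow> real"
  assumes x: "\<And>u. u \<in> V \<Longrightarrow> x u > 0"
    "\<And>u. u \<in> V \<Longrightarrow> (\<Sum>v\<in>V. distance_matrix (S_hypertree r l m k) u v * x v) = c * x u"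
    and a: "a \<in> S_core r l m k"
  shows "x a < (\<Sum>v\<in>first_leg. x v)"
proof -
  define S where "S = S_hypertree r l m k"
  define d where "d u v = real (hdist S u v)" for u v
  \<comment> \<open>\<open>z\<close> and \<open>z'\<close> share the first edge of branch 0 with the
    centre; \<open>(0, 1, 2)\<close> is a vertex because \<open>r - 1 \<ge> 2\<close>.\<close>
  define o' z z' :: "nat \<times> nat \<times> nat" where "o' = (0, 0, 0)" and "z = (0, 1, 1)" and "z' = (0, 1, 2)"
  note SV = S_edge_subset[OF _ r, of _ l m k] S_hconnected[OF r, of l m k]
  have inV: "o' \<in> V" "z \<in> V" "z' \<in> V" "a \<in> V"
    using r l k a core_subset by (auto simp: o'_def z_def z'_def S_verts_iff S_index_iff)
  have zero: "d u v = 0 \<longleftrightarrow> u = v" if "u \<in> V" "v \<in> V" for u v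
    using hdist_eq_0_iff[OF SV(2) that SV(1)] by (simp add: d_def S_def)
  have tri: "d u w \<le> d u v + d v w" if "u \<in> V" "v \<in> V" "w \<in> V" for u v w
    using hdist_triangle[OF SV(2) that SV(1)] unfolding d_def S_def
    by (metis of_nat_add of_nat_le_iff)
  have sym: "d u v = d v u" if "u \<in> V" "v \<in> V" for u v
    using hdist_sym[OF SV(2) that SV(1)] by (simp add: d_def S_def)
  have ge1: "1 \<le> d u v" if "u \<in> V" "v \<in> V" "u \<noteq> v" for u v
    using zero[OF that(1,2)] that(3) by (simp add: d_def)
  have ao: "d a o' \<le> 1"
  proof -
    have "d o' a \<le> 1"
      using a S_hdist_centre[OF _ r, of "fst a" "fst (snd a)" "snd (snd a)" l m k] inV(4)
      by (auto simp: d_def S_def o'_def S_core_def)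
    then show ?thesis
      using sym inV by simp
  qed
  have pos_sum: "0 < (\<Sum>v\<in>V. d o' v * x v)"
  proof (rule sum_pos2[OF finite_S_verts inV(2)])
    show "0 < d o' z * x z"
      using ge1[of o' z] inV x(1)[of z] by (simp add: o'_def z_def)
    show "0 \<le> d o' v * x v" if "v \<in> V" for v
      using x(1)[OF that] by (simp add: d_def)
  qed
  have eig: "(\<Sum>v\<in>V. d u v * x v) = c * x u" if "u \<in> V" for u
    using x(2)[OF that] by (simp add: d_def S_def distance_matrix_def)
  have "0 < c * x o'"
    using pos_sum eig[OF inV(1)] by simp
  then have c: "0 < c"
    using x(1)[OF inV(1)] by (simp add: zero_less_mult_iff)
  have "c * x a = (\<Sum>v\<in>V. d a v * x v)"
    using eig[OF inV(4)] by simp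
  also have "\<dots> < (\<Sum>v\<in>V. (d o' v + d z v + d z' v) * x v)"
  proof (rule sum_strict_mono_ex1[OF finite_S_verts])
    have "d a v \<le> d o' v + d z v + d z' v" if v: "v \<in> V" for v
    proof -
      have "1 \<le> d z z'"
        using ge1 inV by (simp add: z_def z'_def)
      also have "\<dots> \<le> d z v + d z' v"
        using tri[of z v z'] sym[of v z'] inV v by simp
      finally show ?thesis
        using tri[of a o' v] ao inV v by simp
    qed
    then show "\<forall>v\<in>V. d a v * x v \<le> (d o' v + d z v + d z' v) * x v"
      using x(1) by (auto intro!: mult_right_mono dest: less_imp_le)
    \<comment> \<open>Strictness is obtained in the summand \<open>v = a\<close>: its left side is
      0, while \<open>a\<close> has positive distance from at least one of \<open>z\<close> and
      \<open>z'\<close>.\<close>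
    have "z \<noteq> a \<or> z' \<noteq> a"
      by (auto simp: z_def z'_def)
    then have "0 < d z a + d z' a"
      using zero[of z a] zero[of z' a] inV by (auto simp: d_def)
    then have "d a a < d o' a + d z a + d z' a"
      using zero[of a a] inV by (simp add: d_def)
    then have "d a a * x a < (d o' a + d z a + d z' a) * x a"
      using x(1)[OF inV(4)] by (intro mult_strict_right_mono)
    then show "\<exists>v\<in>V. d a v * x v < (d o' v + d z v + d z' v) * x v"
      using inV(4) by blast
  qed
  also have "\<dots> = c * (x o' + x z + x z')"
    using eig inV by (simp add: algebra_simps sum.distrib)
  finally have "x a < x o' + x z + x z'"
    using c by simp
  also have "\<dots> = (\<Sum>v\<in>{o', z, z'}. x v)"
    by (simp add: o'_def z_def z'_def)
  also have "\<dots> \<le> (\<Sum>v\<in>first_leg. x v)"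
  proof (rule sum_mono2)
    show "finite first_leg"
      unfolding first_leg_def by (rule finite_subset[OF _ finite_S_verts]) auto
    show "{o', z, z'} \<subseteq> first_leg"
      using inV by (auto simp: first_leg_def o'_def z_def z'_def)
    show "0 \<le> x v" if "v \<in> first_leg - {o', z, z'}" for v
      using x(1)[of v] that by (auto simp: first_leg_def)
  qed
  finally show ?thesis .
qed

theorem S_spectral_radius_less:
  assumes conn: "hconnected T" and b: "b < k + (m - k * l)" "\<alpha> b \<noteq> (0, 0, 0)"
  shows "distance_spectral_radius (S_hypertree r l m k) < distance_spectral_radius T"
proof -
  define S where "S = S_hypertree r l m k"
  note SV = S_edge_subset[OF _ r, of _ l m k] S_hconnected[OF r, of l m k]
  have V: "finite V" "V \<noteq> {}"
    using finite_S_verts by (auto simp: S_hypertree_def)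
  have symS: "distance_matrix S u v = distance_matrix S v u" if "u \<in> V" "v \<in> V" for u v
    using hdist_sym[OF SV(2) that SV(1)] by (simp add: distance_matrix_def S_def)
  have symT: "distance_matrix T u v = distance_matrix T v u" if "u \<in> V" "v \<in> V" for u v
    using hdist_sym[OF conn, of u v] edge_subset that by (simp add: distance_matrix_def)
  have posS: "0 < distance_matrix S u v" if "u \<in> V" "v \<in> V" "u \<noteq> v" for u v
    using hdist_eq_0_iff[OF SV(2) that(1,2) SV(1)] that(3) by (simp add: distance_matrix_def S_def)
  obtain x where x: "\<And>u. u \<in> V \<Longrightarrow> x u > 0"
    "\<And>u. u \<in> V \<Longrightarrow> (\<Sum>v\<in>V. distance_matrix S u v * x v) = distance_spectral_radius S * x u"
    using Max_eigenvalue_positive_eigenvector[OF V, of "distance_matrix S"] symS posS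
    unfolding distance_spectral_radius_def by (auto simp: distance_matrix_def S_def)
  have hook_core: "hook v \<in> S_core r l m k" if "v \<in> V" for v
    using V_less[of "fst v" "fst (snd v)" "snd (snd v)"] core that by (simp add: hook_def)
  have "distance_spectral_radius S < Max {c. eigenvalue_on V (distance_matrix T) c}"
  proof (rule Max_eigenvalue_less[OF V(1) symT x, where A = first_leg and B = gain_set and p = hook])
    show "first_leg \<subseteq> V" "gain_set \<subseteq> V"
      by (auto simp: first_leg_def gain_set_def)
    then show "hook ` gain_set \<subseteq> V"
      using hook_core core_subset by blast
    have "b \<noteq> 0"
      using b zero by metis
    moreover have "(b, 1, 1) \<in> V"
      using b r l by (auto simp: S_verts_iff S_index_iff)
    ultimately show "gain_set \<noteq> {}"
      using b(2) by (auto simp: gain_set_def)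
    show "x (hook v) < sum x first_leg" if "v \<in> gain_set" for v
      using S_Perron_weight[of x "distance_spectral_radius S" "hook v"] x hook_core that
      by (auto simp: gain_set_def S_def)
    show "distance_matrix S u v + of_bool (u \<in> first_leg \<and> v \<in> gain_set)
        + of_bool (v \<in> first_leg \<and> u \<in> gain_set) - of_bool (v \<in> gain_set \<and> u = hook v)
        - of_bool (u \<in> gain_set \<and> v = hook u) \<le> distance_matrix T u v"
      if "u \<in> V" "v \<in> V" for u v
      using of_nat_mono[OF hdist_diff[OF conn that], where 'a = real]
      by (simp add: distance_matrix_def S_def)
  qed
  then show ?thesis
    by (simp add: distance_spectral_radius_def S_def)
qed

end

section \<open>Rooting power hypertrees\<close>

text \<open>Every vertex other than the root \<open>c\<close> lies in exactly one edge \<open>f\<close> (its parent edge) in which it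
  is not the vertex \<open>att f\<close> nearest to the root.\<close>

definition rooted_at :: "'a hypergraph \<Rightarrow> 'a \<Rightarrow> ('a set \<Rightarrow> 'a) \<Rightarrow> bool" where
  "rooted_at H c att \<longleftrightarrow>
     (\<forall>f\<in>hedges H. att f \<in> f) \<and>
     (\<forall>x\<in>verts H - {c}. \<exists>!f. f \<in> hedges H \<and> x \<in> f \<and> x \<noteq> att f) \<and>
     (\<forall>f\<in>hedges H. c \<in> f \<longrightarrow> att f = c)"

text \<open>With edges of size 2, every path edge is the pair of its two path vertices, so the
  closing edge meets only the first and the last of them. Distinct ends keep the cycle length at
  least 2.\<close>

lemma loose_path_closes_to_cycle:
  assumes G: "uniform 2 G" and P: "loose_path G vs es" and e: "e \<in> hedges G" "e \<notin> set es"
    and ends: "hd vs \<in> e" "last vs \<in> e" "hd vs \<noteq> last vs"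
  shows "loose_cycle G vs (es @ [e])"
proof -
  define p where "p = length es"
  have vs: "length vs = Suc p" "distinct vs" "vs \<noteq> []"
    using P by (auto simp: loose_path_def p_def)
  have e01: "vs ! 0 \<in> e" "vs ! p \<in> e" "vs ! 0 \<noteq> vs ! p"
    using ends vs by (simp_all add: hd_conv_nth last_conv_nth)
  then have "p \<noteq> 0"
    by metis
  have inc: "vs ! i \<in> es ! i" "vs ! Suc i \<in> es ! i" "es ! i \<in> hedges G" if "i < p" for i
    using P that by (auto simp: loose_path_def p_def)
  have pair: "f = {x, y}" if "f \<in> hedges G" "x \<in> f" "y \<in> f" "x \<noteq> y" for f x y
    using G that by (auto simp: uniform_def card_2_iff)
  show ?thesis
    unfolding loose_cycle_def
  proof (intro conjI allI impI)
    fix i assume i: "i < length (es @ [e])"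
    show "vs ! i \<in> (es @ [e]) ! i"
      using i inc[of i] e01 by (cases "i < p") (auto simp: nth_append p_def less_Suc_eq)
    have "Suc i mod length (es @ [e]) = (if i < p then Suc i else 0)"
      using i by (cases "i < p") (auto simp: p_def not_less less_Suc_eq_le)
    then show "vs ! (Suc i mod length (es @ [e])) \<in> (es @ [e]) ! i"
      using i inc[of i] e01 by (cases "i < p") (auto simp: nth_append p_def less_Suc_eq)
  next
    show "(es @ [e]) ! i \<inter> (es @ [e]) ! j = {}"
      if ij: "i < length (es @ [e])" "j < length (es @ [e])"
        "Suc i < j \<and> \<not> (i = 0 \<and> j = length (es @ [e]) - 1)" for i j
    proof (cases "j < p")
      case True
      then show ?thesis
        using P ij by (auto simp: loose_path_def nth_append p_def)
    next
      case False
      then have i: "j = p" "0 < i" "Suc i < p"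
        using ij by (auto simp: p_def)
      then have "es ! i = {vs ! i, vs ! Suc i}" "e = {vs ! 0, vs ! p}"
        using pair[of "es ! i" "vs ! i" "vs ! Suc i"] pair[of e "vs ! 0" "vs ! p"] inc[of i] e01 e vs
        by (auto simp: nth_eq_iff_index_eq)
      then show ?thesis
        using i vs by (auto simp: nth_append p_def nth_eq_iff_index_eq)
    qed
  qed (use P e \<open>p \<noteq> 0\<close> in \<open>auto simp: loose_path_def p_def Suc_le_eq\<close>)
qed

text \<open>Every vertex \<open>v\<close> other than the root selects an edge \<open>pe v\<close> to
  a neighbour nearer to the root. Once each edge is known to be selected, \<open>att\<close> can be
  taken as its nearer end, and \<open>pe v\<close> is then the only edge in which \<open>v\<close>
  is the farther end.\<close>

lemma tree_rooted_at:
  assumes G: "tree G" and c: "c \<in> verts G"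
  shows "\<exists>att. rooted_at G c att"
proof -
  have sub: "\<And>e. e \<in> hedges G \<Longrightarrow> e \<subseteq> verts G" and conn: "hconnected G"
    and acyc: "\<And>vs es. \<not> loose_cycle G vs es" and uni: "uniform 2 G"
    using G by (auto simp: tree_def hypertree_def hypergraph_def)
  have pair: "f = {x, y}" if "f \<in> hedges G" "x \<in> f" "y \<in> f" "x \<noteq> y" for f x y
    using uni that by (auto simp: uniform_def card_2_iff)
  define d where "d v = hdist G c v" for v
  have "\<exists>e u. e \<in> hedges G \<and> e = {u, v} \<and> d u < d v" if v: "v \<in> verts G - {c}" for v
  proof -
    have "d v \<noteq> 0"
      using hdist_eq_0_iff[OF conn c _ sub] v by (auto simp: d_def)
    then obtain n where n: "d v = Suc n"
      by (meson not0_implies_Suc)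
    then have "(c, v) \<in> hadj G ^^ Suc n"
      using hdist_walk[OF conn c, of v] v by (simp add: d_def)
    then obtain u where u: "(c, u) \<in> hadj G ^^ n" "(u, v) \<in> hadj G"
      by auto
    then obtain e where e: "e \<in> hedges G" "u \<in> e" "v \<in> e"
      by (auto simp: hadj_def)
    have "d u < d v"
      using hdist_le_walk[OF sub c u(1)] n by (simp add: d_def)
    then show ?thesis
      using pair[OF e] e(1) by blast
  qed
  then have "\<forall>v. \<exists>e. v \<in> verts G - {c} \<longrightarrow> e \<in> hedges G \<and> (\<exists>u. e = {u, v} \<and> d u < d v)"
    by blast
  then obtain pe where pe: "\<And>v. v \<in> verts G - {c} \<Longrightarrow> pe v \<in> hedges G \<and> (\<exists>u. pe v = {u, v} \<and> d u < d v)"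
    by metis
  \<comment> \<open>The selected edges alone connect every vertex to \<open>c\<close>. An unselected
    edge could be deleted without losing connectivity, and a path between its ends in the remaining
    graph would close up to a cycle.\<close>
  have surj: "\<exists>v\<in>verts G - {c}. e = pe v" if e: "e \<in> hedges G" for e
  proof (rule ccontr)
    assume no: "\<not> ?thesis"
    define G' where "G' = \<lparr>verts = verts G, hedges = hedges G - {e}\<rparr>"
    have "(c, v) \<in> (hadj G')\<^sup>*" if "v \<in> verts G" for v
      using that
    proof (induction "d v" arbitrary: v rule: less_induct)
      case less
      show ?case
      proof (cases "v = c")
        case False
        then obtain u where u: "pe v \<in> hedges G" "pe v = {u, v}" "d u < d v" "pe v \<noteq> e"
          using pe[of v] less.prems no by blast
        then have "(c, u) \<in> (hadj G')\<^sup>*"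
          using less.hyps sub by blast
        moreover have "(u, v) \<in> hadj G'"
          using u by (auto simp: hadj_def G'_def)
        ultimately show ?thesis
          by (rule rtrancl_into_rtrancl)
      qed simp
    qed
    then have conn': "hconnected G'"
      using sub by (intro hconnected_walkI[of _ c]) (auto simp: G'_def)
    obtain a b where ab: "e = {a, b}" "a \<noteq> b"
      using uni e by (auto simp: uniform_def card_2_iff)
    then have "a \<in> verts G'" "b \<in> verts G'"
      using sub[OF e] by (auto simp: G'_def)
    then obtain vs es where P: "loose_path G' vs es" "hd vs = a" "last vs = b"
      using conn' unfolding hconnected_def loose_path_between_def by blast
    then have "loose_path G vs es" "e \<notin> set es"
      by (auto simp: loose_path_def G'_def)
    then have "loose_cycle G vs (es @ [e])"
      using P(2,3) ab e by (intro loose_path_closes_to_cycle[OF uni]) auto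
    then show False
      using acyc by blast
  qed
  have "\<forall>e. \<exists>u. e \<in> hedges G \<longrightarrow> (\<exists>v\<in>verts G - {c}. e = pe v \<and> e = {u, v} \<and> d u < d v)"
    using surj pe by metis
  then obtain att where att: "\<And>e. e \<in> hedges G \<Longrightarrow>
      \<exists>v\<in>verts G - {c}. e = pe v \<and> e = {att e, v} \<and> d (att e) < d v"
    by metis
  have "rooted_at G c att"
    unfolding rooted_at_def
  proof (intro conjI ballI impI)
    show "att f \<in> f" if "f \<in> hedges G" for f
      using att[OF that] by blast
    show "att f = c" if f: "f \<in> hedges G" "c \<in> f" for f
    proof -
      obtain v where "v \<noteq> c" "f = {att f, v}"
        using att[OF f(1)] by blast
      then show ?thesis
        using f(2) by (metis insertE singletonD)
    qed
    fix x assume x: "x \<in> verts G - {c}"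
    show "\<exists>!f. f \<in> hedges G \<and> x \<in> f \<and> x \<noteq> att f"
    proof (rule ex1I[of _ "pe x"])
      obtain u where u: "pe x \<in> hedges G" "pe x = {u, x}" "d u < d x"
        using pe[OF x] by blast
      obtain v where v: "pe x = {att (pe x), v}" "d (att (pe x)) < d v"
        using att[OF u(1)] by blast
      have "x \<noteq> att (pe x)"
      proof
        assume *: "x = att (pe x)"
        then have "v = u"
          using u(2,3) v by (metis doubleton_eq_iff)
        then show False
          using * u(3) v(2) by simp
      qed
      then show "pe x \<in> hedges G \<and> x \<in> pe x \<and> x \<noteq> att (pe x)"
        using u by simp
    next
      fix f assume f: "f \<in> hedges G \<and> x \<in> f \<and> x \<noteq> att f"
      then obtain v where "f = pe v" "f = {att f, v}"
        using att[of f] by blast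
      then show "f = pe x"
        using f by (metis insertE singletonD)
    qed
  qed
  then show ?thesis
    by blast
qed

section \<open>Transfer of the rooting from trees to their powers\<close>

lemma two_le_hdegree:
  assumes "finite (hedges H)" "e \<in> hedges H" "f \<in> hedges H" "e \<noteq> f" "x \<in> e" "x \<in> f"
  shows "2 \<le> hdegree H x"
proof -
  have "card {e, f} \<le> card {e \<in> hedges H. x \<in> e}"
    using assms by (intro card_mono) auto
  then show ?thesis
    using assms(4) by (simp add: hdegree_def)
qed

text \<open>Each added vertex lies in a single edge, so a vertex of degree at least 2 belongs to the
  underlying tree and can serve as its root. The rooting lifts because an edge of the power meets
  \<open>verts G\<close> exactly in the tree edge it comes from; the added vertices have that edge
  as parent.\<close>

lemma power_hypertree_rooted:
  assumes T: "power_hypertree r T" and r: "r \<ge> 2"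
  shows "finite (verts T)" and "finite (hedges T)" and "\<And>e. e \<in> hedges T \<Longrightarrow> e \<subseteq> verts T"
    and "\<And>e. e \<in> hedges T \<Longrightarrow> finite e \<and> card e = r" and "hconnected T"
    and "\<And>c. 2 \<le> hdegree T c \<Longrightarrow> c \<in> verts T \<and> (\<exists>att. rooted_at T c att)"
proof -
  obtain G where G: "tree G" and P: "is_power r G T"
    using T by (auto simp: power_hypertree_def)
  obtain W where W: "\<And>e. e \<in> hedges G \<Longrightarrow> finite (W e) \<and> card (W e) = r - 2 \<and> W e \<inter> verts G = {}"
    and disj: "\<And>e f. e \<in> hedges G \<Longrightarrow> f \<in> hedges G \<Longrightarrow> e \<noteq> f \<Longrightarrow> W e \<inter> W f = {}"
    and VT: "verts T = verts G \<union> (\<Union>e\<in>hedges G. W e)"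
    and ET: "hedges T = (\<lambda>e. e \<union> W e) ` hedges G"
    using P[unfolded is_power_def] by (elim exE conjE) (metis (no_types, lifting))
  have sub: "\<And>e. e \<in> hedges G \<Longrightarrow> e \<subseteq> verts G" and conn: "hconnected G"
    and fin: "finite (verts G)" and card2: "\<And>e. e \<in> hedges G \<Longrightarrow> card e = 2"
    using G by (auto simp: tree_def hypertree_def hypergraph_def uniform_def)
  have finE: "finite (hedges G)"
    using fin sub by (intro finite_subset[of "hedges G" "Pow (verts G)"]) auto
  show "finite (verts T)" "finite (hedges T)"
    using fin finE W by (auto simp: VT ET)
  show subT: "e \<subseteq> verts T" if "e \<in> hedges T" for e
    using that sub by (auto simp: VT ET)
  show "finite e \<and> card e = r" if e: "e \<in> hedges T" for e
  proof -
    obtain f where f: "f \<in> hedges G" "e = f \<union> W f"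
      using e by (auto simp: ET)
    have "finite f"
      using sub[OF f(1)] fin by (rule finite_subset)
    moreover have "f \<inter> W f = {}"
      using sub[OF f(1)] W[OF f(1)] by blast
    ultimately show ?thesis
      using f W card2 r by (simp add: card_Un_disjoint)
  qed
  have trace: "(e \<union> W e) \<inter> verts G = e" if "e \<in> hedges G" for e
    using sub[OF that] W[OF that] by blast
  show "hconnected T"
  proof (cases "verts G = {}")
    case True
    then have "hedges G = {}"
      using sub card2 by fastforce
    then show ?thesis
      using True VT by (simp add: hconnected_def)
  next
    case False
    then obtain c where c: "c \<in> verts G"
      by blast
    have mono: "(hadj G)\<^sup>* \<subseteq> (hadj T)\<^sup>*"
      by (rule rtrancl_mono) (auto simp: hadj_def ET)
    have reach: "(c, v) \<in> (hadj T)\<^sup>*" if "v \<in> verts G" for v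
      using relpow_imp_rtrancl[OF hdist_walk[OF conn c that]] mono by blast
    show ?thesis
    proof (rule hconnected_walkI[OF subT, of c])
      fix v assume "v \<in> verts T"
      then consider "v \<in> verts G" | e where "e \<in> hedges G" "v \<in> W e"
        by (auto simp: VT)
      then show "(c, v) \<in> (hadj T)\<^sup>*"
      proof cases
        case 2
        obtain a where "a \<in> e"
          using card2[OF 2(1)] by fastforce
        then have "(a, v) \<in> hadj T" "a \<in> verts G"
          using 2 sub by (auto simp: hadj_def ET)
        then show ?thesis
          using reach by (meson rtrancl_into_rtrancl)
      qed (rule reach)
    qed
  qed
  fix c assume deg: "2 \<le> hdegree T c"
  have c: "c \<in> verts G"
  proof (rule ccontr)
    assume "c \<notin> verts G"
    have "e = f" if "e \<in> hedges T" "f \<in> hedges T" "c \<in> e" "c \<in> f" for e f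
    proof -
      obtain e' f' where "e' \<in> hedges G" "f' \<in> hedges G" "e = e' \<union> W e'" "f = f' \<union> W f'"
        using \<open>e \<in> hedges T\<close> \<open>f \<in> hedges T\<close> by (auto simp: ET)
      moreover from this have "c \<in> W e'" "c \<in> W f'"
        using \<open>c \<in> e\<close> \<open>c \<in> f\<close> sub \<open>c \<notin> verts G\<close> by auto
      ultimately show ?thesis
        using disj[of e' f'] by auto
    qed
    then have "hdegree T c \<le> 1"
      unfolding hdegree_def One_nat_def using finE by (subst card_le_Suc0_iff_eq) (auto simp: ET)
    then show False
      using deg by simp
  qed
  obtain att where att: "rooted_at G c att"
    using tree_rooted_at[OF G c] by blast
  define attT where "attT f = att (f \<inter> verts G)" for f
  have attT: "attT (e \<union> W e) = att e" "att e \<in> e" if "e \<in> hedges G" for e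
    using that att trace by (auto simp: attT_def rooted_at_def)
  have "rooted_at T c attT"
    unfolding rooted_at_def
  proof (intro conjI ballI impI)
    show "attT f \<in> f" if "f \<in> hedges T" for f
      using that attT by (auto simp: ET)
    show "attT f = c" if f: "f \<in> hedges T" "c \<in> f" for f
    proof -
      obtain e where e: "e \<in> hedges G" "f = e \<union> W e"
        using f(1) by (auto simp: ET)
      then have "c \<in> e"
        using f(2) c W[OF e(1)] by auto
      then show ?thesis
        using e att attT by (simp add: rooted_at_def)
    qed
    fix x assume x: "x \<in> verts T - {c}"
    show "\<exists>!f. f \<in> hedges T \<and> x \<in> f \<and> x \<noteq> attT f"
    proof (cases "x \<in> verts G")
      case True
      then have "\<exists>!f. f \<in> hedges G \<and> x \<in> f \<and> x \<noteq> att f"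
        using att x by (simp add: rooted_at_def)
      then obtain e where e: "e \<in> hedges G \<and> x \<in> e \<and> x \<noteq> att e"
        and uniq: "\<forall>f. f \<in> hedges G \<and> x \<in> f \<and> x \<noteq> att f \<longrightarrow> f = e"
        by (rule ex1E)
      show ?thesis
      proof (rule ex1I[of _ "e \<union> W e"])
        show "e \<union> W e \<in> hedges T \<and> x \<in> e \<union> W e \<and> x \<noteq> attT (e \<union> W e)"
          using e attT by (auto simp: ET)
        show "f = e \<union> W e" if f: "f \<in> hedges T \<and> x \<in> f \<and> x \<noteq> attT f" for f
        proof -
          obtain g where g: "g \<in> hedges G" "f = g \<union> W g"
            using f by (auto simp: ET)
          then have "x \<in> g"
            using f True W[OF g(1)] by auto
          then show ?thesis
            using uniq g f attT(1)[OF g(1)] by metis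
        qed
      qed
    next
      case False
      then obtain e where e: "e \<in> hedges G" "x \<in> W e"
        using x by (auto simp: VT)
      show ?thesis
      proof (rule ex1I[of _ "e \<union> W e"])
        have "att e \<in> verts G"
          using attT(2)[OF e(1)] sub[OF e(1)] by auto
        then show "e \<union> W e \<in> hedges T \<and> x \<in> e \<union> W e \<and> x \<noteq> attT (e \<union> W e)"
          using e attT False by (auto simp: ET)
        show "f = e \<union> W e" if f: "f \<in> hedges T \<and> x \<in> f \<and> x \<noteq> attT f" for f
        proof -
          obtain g where g: "g \<in> hedges G" "f = g \<union> W g"
            using f by (auto simp: ET)
          then have "x \<in> W g"
            using f False sub[OF g(1)] by auto
          then show ?thesis
            using g disj[of g e] e by auto
        qed
      qed
    qed
  qed
  then show "c \<in> verts T \<and> (\<exists>att. rooted_at T c att)"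
    using c VT by blast
qed

section \<open>Pendant paths\<close>

context
  fixes T :: "'a hypergraph" and vs :: "'a list" and es :: "'a set list"
  assumes P: "pendant_path T vs es" and fin: "finite (hedges T)"
begin

lemma pendant_path_edge:
  assumes "i < length es"
  shows "es ! i \<in> hedges T" "vs ! i \<in> es ! i" "vs ! Suc i \<in> es ! i"
  using assms P by (auto simp: pendant_path_def loose_path_def)

lemma pendant_path_vertex_eq_iff:
  "i \<le> length es \<Longrightarrow> j \<le> length es \<Longrightarrow> vs ! i = vs ! j \<longleftrightarrow> i = j"
  using P by (auto simp: pendant_path_def loose_path_def nth_eq_iff_index_eq)

lemma pendant_path_edge_eq_iff:
  "i < length es \<Longrightarrow> j < length es \<Longrightarrow> es ! i = es ! j \<longleftrightarrow> i = j"
  using P by (auto simp: pendant_path_def loose_path_def nth_eq_iff_index_eq)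

lemma pendant_path_hdegree:
  assumes "i < length es"
  shows "2 \<le> hdegree T (vs ! Suc i)"
  using assms P by (cases "Suc i = length es") (auto simp: pendant_path_def)

text \<open>Vertices of an edge that do not link it to its neighbours on the path have degree 1, and
  so has the free end \<open>vs ! 0\<close>. This pins down where a second pendant path can enter or
  leave the edge.\<close>

lemma pendant_path_branch_vertex:
  assumes "i < length es" "x \<in> es ! i" "2 \<le> hdegree T x"
  shows "x = vs ! Suc i \<or> x = vs ! i \<and> 1 \<le> i"
proof -
  have "x = vs ! i \<or> x = vs ! Suc i"
    using P assms by (force simp: pendant_path_def)
  moreover have "x \<noteq> vs ! 0"
    using P assms by (auto simp: pendant_path_def)
  ultimately show ?thesis
    by (cases i) auto
qed

text \<open>The two path edges at an inner vertex already exhaust its degree 2.\<close>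

lemma pendant_path_inner_edges:
  assumes "1 \<le> i" "i < length es" "e \<in> hedges T" "vs ! i \<in> e"
  shows "e = es ! (i - 1) \<or> e = es ! i"
proof -
  have "hdegree T (vs ! i) = 2"
    using P assms by (auto simp: pendant_path_def)
  moreover have "{es ! (i - 1), es ! i} \<subseteq> {e \<in> hedges T. vs ! i \<in> e}"
    using pendant_path_edge[of i] pendant_path_edge[of "i - 1"] assms by auto
  moreover have "card {es ! (i - 1), es ! i} = 2"
    using pendant_path_edge_eq_iff[of "i - 1" i] assms by simp
  ultimately have "{e \<in> hedges T. vs ! i \<in> e} = {es ! (i - 1), es ! i}"
    using fin by (intro card_subset_eq[symmetric]) (auto simp: hdegree_def)
  then show ?thesis
    using assms by auto
qed

end

text \<open>Two pendant paths that traverse a common edge in the same direction can be traced back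
  together: the vertex before it is inner on both, so its other edge is common too. The degree 1 at
  the free ends makes both paths start simultaneously.\<close>

lemma pendant_path_aligned_first:
  assumes fin: "finite (hedges T)" and P: "pendant_path T vs es" and Q: "pendant_path T ws fs"
    and "i < length es" "j < length fs" "es ! i = fs ! j" "vs ! Suc i = ws ! Suc j"
  shows "es ! 0 = fs ! 0"
  using assms(4-)
proof (induction i arbitrary: j)
  case 0
  have "j = 0"
  proof (rule ccontr)
    assume "j \<noteq> 0"
    then have "ws ! j \<in> es ! 0" "2 \<le> hdegree T (ws ! j)"
      using 0 pendant_path_edge[OF Q fin, of j] pendant_path_hdegree[OF Q fin, of "j - 1"] by auto
    then have "ws ! j = ws ! Suc j"
      using pendant_path_branch_vertex[OF P fin, of 0 "ws ! j"] 0 by auto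
    then show False
      using pendant_path_vertex_eq_iff[OF Q fin, of j "Suc j"] 0 by simp
  qed
  then show ?case
    using 0 by simp
next
  case (Suc i)
  have "vs ! Suc i \<in> fs ! j" "2 \<le> hdegree T (vs ! Suc i)"
    using Suc.prems pendant_path_edge[OF P fin, of "Suc i"] pendant_path_hdegree[OF P fin, of i] by auto
  moreover have "vs ! Suc i \<noteq> ws ! Suc j"
    using Suc.prems pendant_path_vertex_eq_iff[OF P fin, of "Suc i" "Suc (Suc i)"] by auto
  ultimately have *: "vs ! Suc i = ws ! j" "1 \<le> j"
    using pendant_path_branch_vertex[OF Q fin, of j "vs ! Suc i"] Suc.prems by auto
  have "fs ! (j - 1) \<in> hedges T" "vs ! Suc i \<in> fs ! (j - 1)"
    using pendant_path_edge[OF Q fin, of "j - 1"] * Suc.prems by auto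
  then have "fs ! (j - 1) = es ! i \<or> fs ! (j - 1) = es ! Suc i"
    using pendant_path_inner_edges[OF P fin, of "Suc i" "fs ! (j - 1)"] Suc.prems by auto
  then have "es ! i = fs ! (j - 1)"
    using pendant_path_edge_eq_iff[OF Q fin, of "j - 1" j] Suc.prems * by auto
  then show ?case
    using Suc.IH[of "j - 1"] Suc.prems * by simp
qed

text \<open>From the free end onwards there is no choice: an inner vertex has degree 2 and thus
  leaves a single continuation.\<close>

lemma pendant_path_determined_by_first:
  assumes fin: "finite (hedges T)" and P: "pendant_path T vs es" and Q: "pendant_path T ws fs"
    and len: "length es = length fs" and "es ! 0 = fs ! 0"
  shows "es = fs"
proof -
  have "es ! i = fs ! i \<and> vs ! Suc i = ws ! Suc i" if "i < length es" for i
    using that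
  proof (induction i)
    case 0
    then have "vs ! Suc 0 = ws ! Suc 0"
      using pendant_path_branch_vertex[OF Q fin, of 0 "vs ! Suc 0"] pendant_path_edge[OF P fin, of 0]
        pendant_path_hdegree[OF P fin, of 0] assms(5) len by auto
    then show ?case
      using assms(5) by simp
  next
    case (Suc i)
    then have IH: "es ! i = fs ! i" "vs ! Suc i = ws ! Suc i"
      by auto
    have "es ! Suc i \<in> hedges T" "ws ! Suc i \<in> es ! Suc i"
      using pendant_path_edge[OF P fin, of "Suc i"] Suc.prems IH by auto
    then have "es ! Suc i = fs ! i \<or> es ! Suc i = fs ! Suc i"
      using pendant_path_inner_edges[OF Q fin, of "Suc i" "es ! Suc i"] Suc.prems len by auto
    moreover have "es ! Suc i \<noteq> es ! i"
      using pendant_path_edge_eq_iff[OF P fin, of "Suc i" i] Suc.prems by simp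
    ultimately have e: "es ! Suc i = fs ! Suc i"
      using IH by auto
    have "vs ! Suc (Suc i) = ws ! Suc (Suc i)"
      using pendant_path_branch_vertex[OF Q fin, of "Suc i" "vs ! Suc (Suc i)"]
        pendant_path_edge[OF P fin, of "Suc i"] pendant_path_hdegree[OF P fin, of "Suc i"] e IH
        pendant_path_vertex_eq_iff[OF P fin, of "Suc i" "Suc (Suc i)"] Suc.prems len
      by auto
    then show ?case
      using e by simp
  qed
  then show ?thesis
    using len by (intro nth_equalityI) auto
qed

text \<open>Advancing on \<open>fs\<close> means retreating on \<open>es\<close>. The retreat cannot
  reach the free end of \<open>es\<close>, since every vertex \<open>ws ! Suc j\<close> on the way
  has degree at least 2; so \<open>fs\<close> ends earlier, at an inner vertex of
  \<open>es\<close>.\<close>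

lemma pendant_path_opposite_end:
  assumes fin: "finite (hedges T)" and P: "pendant_path T vs es" and Q: "pendant_path T ws fs"
    and "i < length es" "j < length fs" "es ! i = fs ! j" "vs ! i = ws ! Suc j" "1 \<le> i"
  shows "\<exists>q. 1 \<le> q \<and> q < length es \<and> ws ! length fs = vs ! q"
  using assms(4-)
proof (induction i arbitrary: j)
  case (Suc i)
  show ?case
  proof (cases "Suc j = length fs")
    case True
    then show ?thesis
      using Suc.prems by (metis)
  next
    case False
    then have j: "Suc j < length fs"
      using Suc.prems by simp
    have "fs ! Suc j \<in> hedges T" "vs ! Suc i \<in> fs ! Suc j"
      using pendant_path_edge[OF Q fin j] Suc.prems by auto
    then have "fs ! Suc j = es ! i \<or> fs ! Suc j = es ! Suc i"
      using pendant_path_inner_edges[OF P fin, of "Suc i" "fs ! Suc j"] Suc.prems by auto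
    then have e: "es ! i = fs ! Suc j"
      using pendant_path_edge_eq_iff[OF Q fin, of j "Suc j"] Suc.prems j by auto
    have "ws ! Suc (Suc j) \<in> es ! i" "2 \<le> hdegree T (ws ! Suc (Suc j))"
      using e pendant_path_edge[OF Q fin j] pendant_path_hdegree[OF Q fin j] by auto
    moreover have "ws ! Suc (Suc j) \<noteq> vs ! Suc i"
      using pendant_path_vertex_eq_iff[OF Q fin, of "Suc j" "Suc (Suc j)"] Suc.prems j by auto
    ultimately have "ws ! Suc (Suc j) = vs ! i \<and> 1 \<le> i"
      using pendant_path_branch_vertex[OF P fin, of i "ws ! Suc (Suc j)"] Suc.prems by auto
    then show ?thesis
      using Suc.IH[of "Suc j"] Suc.prems e j by auto
  qed
qed simp

lemma hedges_subset_of_closed: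
  assumes conn: "hconnected T" and sub: "\<And>e. e \<in> hedges T \<Longrightarrow> e \<subseteq> verts T \<and> e \<noteq> {}"
    and F: "F \<subseteq> hedges T" "F \<noteq> {}"
    and closed: "\<And>e f x. f \<in> F \<Longrightarrow> e \<in> hedges T \<Longrightarrow> x \<in> e \<Longrightarrow> x \<in> f \<Longrightarrow> e \<in> F"
  shows "hedges T \<subseteq> F"
proof
  fix e assume e: "e \<in> hedges T"
  obtain f x where f: "f \<in> F" "x \<in> f"
    using F sub by blast
  obtain y where y: "y \<in> e"
    using sub[OF e] by blast
  have "(x, y) \<in> (hadj T)\<^sup>*"
    using relpow_imp_rtrancl[OF hdist_walk[OF conn, of x y]] f F y e sub by blast
  then have "y \<in> \<Union>F"
  proof (induction rule: rtrancl_induct)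
    case base
    then show ?case
      using f by blast
  next
    case (step y z)
    then show ?case
      using closed unfolding hadj_def by blast
  qed
  then show "e \<in> F"
    using closed e y by blast
qed

text \<open>Two pendant paths that share an edge run through it in opposite directions; then each of them
  ends at an inner vertex of the other, and together they exhaust the hypergraph.\<close>

lemma pendant_paths_overlap:
  assumes fin: "finite (hedges T)" and conn: "hconnected T"
    and sub: "\<And>e. e \<in> hedges T \<Longrightarrow> e \<subseteq> verts T \<and> e \<noteq> {}"
    and P: "pendant_path T vs es" and Q: "pendant_path T ws fs"
    and len: "length es = l" "length fs = l" and ne: "es \<noteq> fs"
    and share: "set es \<inter> set fs \<noteq> {}"
  shows "card (hedges T) < 2 * l"
proof -
  obtain i j where ij: "i < l" "j < l" "es ! i = fs ! j"
    using share len by (metis disjoint_iff in_set_conv_nth)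
  have not_al: "vs ! Suc i \<noteq> ws ! Suc j"
    using pendant_path_aligned_first[OF fin P Q, of i j] pendant_path_determined_by_first[OF fin P Q]
      ne len ij by auto
  have 1: "vs ! Suc i = ws ! j" "1 \<le> j"
    using pendant_path_branch_vertex[OF Q fin, of j "vs ! Suc i"] pendant_path_edge[OF P fin, of i]
      pendant_path_hdegree[OF P fin, of i] ij len not_al by auto
  have 2: "ws ! Suc j = vs ! i" "1 \<le> i"
    using pendant_path_branch_vertex[OF P fin, of i "ws ! Suc j"] pendant_path_edge[OF Q fin, of j]
      pendant_path_hdegree[OF Q fin, of j] ij len not_al by auto
  obtain q where q: "1 \<le> q" "q < l" "ws ! l = vs ! q"
    using pendant_path_opposite_end[OF fin P Q, of i j] ij len 2 by auto
  obtain q' where q': "1 \<le> q'" "q' < l" "vs ! l = ws ! q'"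
    using pendant_path_opposite_end[OF fin Q P, of j i] ij len 1 by auto
  define F where "F = set es \<union> set fs"
  \<comment> \<open>The index \<open>a = l\<close> is included because each path ends at an inner
    vertex of the other one, where the edges are already accounted for.\<close>
  have inner: "e \<in> F" if "1 \<le> a" "a \<le> l" "e \<in> hedges T" "vs ! a \<in> e \<or> ws ! a \<in> e" for a e
  proof -
    have vs: "e \<in> set es" if "1 \<le> a" "a < l" "vs ! a \<in> e" for a
      using pendant_path_inner_edges[OF P fin, of a e] that \<open>e \<in> hedges T\<close> len by auto
    have ws: "e \<in> set fs" if "1 \<le> a" "a < l" "ws ! a \<in> e" for a
      using pendant_path_inner_edges[OF Q fin, of a e] that \<open>e \<in> hedges T\<close> len by auto
    show ?thesis
      using vs[of a] ws[of a] vs[of q] ws[of q'] q q' that unfolding F_def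
      by (cases "a = l") auto
  qed
  have "hedges T \<subseteq> F"
  proof (rule hedges_subset_of_closed[OF conn sub])
    show "F \<subseteq> hedges T"
      using P Q by (auto simp: F_def pendant_path_def loose_path_def)
    show "F \<noteq> {}"
      using share by (auto simp: F_def)
    fix e f x assume *: "f \<in> F" "e \<in> hedges T" "x \<in> e" "x \<in> f"
    show "e \<in> F"
    proof (cases "e = f")
      case False
      have "f \<in> hedges T"
        using * \<open>F \<subseteq> hedges T\<close> by blast
      then have deg: "2 \<le> hdegree T x"
        using two_le_hdegree[OF fin] * False by metis
      consider a where "a < l" "f = es ! a" | a where "a < l" "f = fs ! a"
        using *(1) len unfolding F_def by (metis UnE in_set_conv_nth)
      then show ?thesis
      proof cases
        case 1
        then show ?thesis
          using pendant_path_branch_vertex[OF P fin, of a x] * deg len inner[of a e] inner[of "Suc a" e]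
          by auto
      next
        case 2
        then show ?thesis
          using pendant_path_branch_vertex[OF Q fin, of a x] * deg len inner[of a e] inner[of "Suc a" e]
          by auto
      qed
    qed (use * in simp)
  qed auto
  then have "card (hedges T) \<le> card F"
    by (intro card_mono) (auto simp: F_def)
  moreover have "card F + card (set es \<inter> set fs) = card (set es) + card (set fs)"
    unfolding F_def using card_Un_Int[of "set es" "set fs"] by simp
  moreover have "card (set es \<inter> set fs) > 0"
    using share by (simp add: card_gt_0_iff)
  moreover have "card (set es) \<le> l" "card (set fs) \<le> l"
    using len card_length[of es] card_length[of fs] by auto
  ultimately show ?thesis
    by linarith
qed

section \<open>Orientation of pendant paths relative to the root\<close>

lemma rooted_att_hdegree:
  assumes "rooted_at T c att" "finite (hedges T)" "2 \<le> hdegree T c" "f \<in> hedges T" "f \<subseteq> verts T"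
  shows "2 \<le> hdegree T (att f)"
proof (cases "att f = c")
  case False
  have "att f \<in> f"
    using assms by (simp add: rooted_at_def)
  moreover have "att f \<in> verts T - {c}"
    using assms(5) False \<open>att f \<in> f\<close> by auto
  \<comment> \<open>\<open>g\<close> is the parent edge of \<open>att f\<close>; it is not
    \<open>f\<close>, because \<open>att f\<close> is the nearest vertex of \<open>f\<close> to the
    root.\<close>
  then obtain g where "g \<in> hedges T" "att f \<in> g" "att f \<noteq> att g"
    using assms(1) unfolding rooted_at_def by metis
  ultimately show ?thesis
    using two_le_hdegree[OF assms(2,4), of g "att f"] by auto
qed (use assms in simp)

text \<open>In the first edge only \<open>vs ! 1\<close> has degree at least 2, so that edge points
  away from the free end. This direction persists: if it turned round at an inner vertex, both edges
  there would have this vertex as their \<open>att\<close>, and the vertex, not being the root,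
  would lack a parent edge.\<close>

lemma pendant_path_towards_root:
  assumes root: "rooted_at T c att" and fin: "finite (hedges T)" and c: "2 \<le> hdegree T c"
    and sub: "\<And>e. e \<in> hedges T \<Longrightarrow> e \<subseteq> verts T"
    and P: "pendant_path T vs es" and inner: "\<And>q. 1 \<le> q \<Longrightarrow> q < length es \<Longrightarrow> vs ! q \<noteq> c"
    and "i < length es"
  shows "att (es ! i) = vs ! Suc i"
  using assms(7)
proof (induction i)
  case 0
  then have "es ! 0 \<in> hedges T"
    using pendant_path_edge[OF P fin] by blast
  then show ?case
    using pendant_path_branch_vertex[OF P fin, of 0 "att (es ! 0)"] 0 root
      rooted_att_hdegree[OF root fin c] sub by (auto simp: rooted_at_def)
next
  case (Suc i)
  have e: "es ! Suc i \<in> hedges T"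
    using pendant_path_edge[OF P fin] Suc.prems by blast
  then have "att (es ! Suc i) = vs ! Suc (Suc i) \<or> att (es ! Suc i) = vs ! Suc i"
    using pendant_path_branch_vertex[OF P fin, of "Suc i" "att (es ! Suc i)"] Suc.prems root
      rooted_att_hdegree[OF root fin c e] sub[OF e] by (auto simp: rooted_at_def)
  moreover have "att (es ! Suc i) \<noteq> vs ! Suc i"
  proof
    assume *: "att (es ! Suc i) = vs ! Suc i"
    have "vs ! Suc i \<in> verts T - {c}"
      using pendant_path_edge[OF P fin, of "Suc i"] sub[OF e] inner[of "Suc i"] Suc.prems by auto
    then obtain g where g: "g \<in> hedges T" "vs ! Suc i \<in> g" "vs ! Suc i \<noteq> att g"
      using root unfolding rooted_at_def by metis
    then have "g = es ! i \<or> g = es ! Suc i"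
      using pendant_path_inner_edges[OF P fin, of "Suc i" g] Suc.prems by auto
    then show False
      using g * Suc by auto
  qed
  ultimately show ?case
    by blast
qed

section \<open>The normal form\<close>

lemma ex_bij_betw_pointed:
  assumes "finite A" "card A = n" "a \<in> A"
  shows "\<exists>h. bij_betw h {1..n} A \<and> h 1 = a"
proof -
  have n: "n \<ge> 1"
    using assms by (metis One_nat_def Suc_leI card_gt_0_iff empty_iff)
  have "card {2..n} = card (A - {a})"
    using assms by simp
  then obtain g where g: "bij_betw g {2..n} (A - {a})"
    using finite_same_card_bij[of "{2..n}" "A - {a}"] assms by auto
  define h where "h i = (if i = 1 then a else g i)" for i :: nat
  have "bij_betw h {2..n} (A - {a})"
    using g by (rule bij_betw_cong[THEN iffD1, rotated]) (auto simp: h_def)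
  then have "bij_betw h ({2..n} \<union> {1}) (A - {a} \<union> {a})"
    by (intro bij_betw_combine) (auto simp: h_def bij_betw_def)
  moreover have "{2..n} \<union> {1} = {1..n}" "A - {a} \<union> {a} = A"
    using n assms by auto
  ultimately show ?thesis
    by (intro exI[of _ h]) (simp add: h_def)
qed

text \<open>Removing \<open>att f\<close> from each edge \<open>f\<close> leaves sets of size
  \<open>r - 1\<close> that partition the vertices other than the root, just as the sets
  \<open>S_own\<close> do in \<open>S\<close>. Matching edges with edges therefore matches the
  vertices, and \<open>\<alpha>\<close> is read off from \<open>att\<close> on the first edges of
  the branches.\<close>

lemma power_hypertree_normal_form:
  assumes r: "r \<ge> 3" and l: "l \<ge> 1" and k: "k \<ge> 1" and T: "power_hypertree r T"
    and m: "card (hedges T) = m" "k * l \<le> m" and two: "k \<ge> 2 \<Longrightarrow> 2 * l \<le> m"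
    and card_PP: "card (pendant_paths T l) = k"
  obtains \<alpha> where "branches r l m k \<alpha>" "hiso (branch_hypergraph r l m k \<alpha>) T"
proof -
  note T' = power_hypertree_rooted[OF T order_trans[of 2 3 r, OF _ r, simplified]]
  note fin = T'(2) and sub = T'(3) and edge_card = T'(4) and conn = T'(5) and root_ex = T'(6)
  have sub_ne: "e \<subseteq> verts T \<and> e \<noteq> {}" if "e \<in> hedges T" for e
    using sub[OF that] edge_card[OF that] r by auto
  have "finite (pendant_paths T l)"
    using card_PP k by (intro card_ge_0_finite) simp
  from ex_bij_betw_nat_finite[OF this]
  obtain E where E: "bij_betw E {0..<k} (pendant_paths T l)"
    using card_PP by auto
  have "\<forall>i. \<exists>vs. i < k \<longrightarrow> length (E i) = l \<and> pendant_path T vs (E i)"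
    using bij_betwE[OF E] by (auto simp: pendant_paths_def)
  then obtain VS where VS: "\<And>i. i < k \<Longrightarrow> length (E i) = l \<and> pendant_path T (VS i) (E i)"
    by metis
  have len: "length (E i) = l" and PP: "pendant_path T (VS i) (E i)" if "i < k" for i
    using VS[OF that] by auto
  have E_disj: "set (E i) \<inter> set (E j) = {}" if "i < k" "j < k" "i \<noteq> j" for i j
  proof (rule ccontr)
    assume "set (E i) \<inter> set (E j) \<noteq> {}"
    moreover have "E i \<noteq> E j"
      using E that by (auto simp: bij_betw_def inj_on_def)
    ultimately have "card (hedges T) < 2 * l"
      using pendant_paths_overlap[OF fin conn sub_ne PP PP, of i j l] that len by auto
    moreover have "2 * l \<le> m"
      using two that by auto
    ultimately show False
      using m(1) by simp
  qed
  have E_nth: "E i ! q \<in> set (E i)" if "i < k" "q < l" for i q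
    using that len by simp
  have E_sub: "set (E i) \<subseteq> hedges T" if "i < k" for i
    using PP[OF that] by (auto simp: pendant_path_def loose_path_def)
  have E_same: "i = j" if "e \<in> set (E i)" "e \<in> set (E j)" "i < k" "j < k" for e i j
    using E_disj[of i j] that by blast
  have edge: "E i ! q \<in> hedges T" "VS i ! q \<in> E i ! q" "VS i ! Suc q \<in> E i ! q"
    if "i < k" "q < l" for i q
    using pendant_path_edge[OF PP[OF that(1)] fin, of q] that len by auto
  have VS_eq: "VS i ! p = VS i ! q \<longleftrightarrow> p = q" if "i < k" "p \<le> l" "q \<le> l" for i p q
    using pendant_path_vertex_eq_iff[OF PP[OF that(1)] fin] that len by auto
  have inner_edge: "e \<in> set (E i)" if "i < k" "1 \<le> q" "q < l" "e \<in> hedges T" "VS i ! q \<in> e" for i q e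
    using pendant_path_inner_edges[OF PP[OF that(1)] fin, of q e] that len E_nth[of i q]
      E_nth[of i "q - 1"] by auto
  \<comment> \<open>Rooting at the end of path 0 makes branch 0 hang at the centre, as the locale
    \<open>branches\<close> demands.\<close>
  define c where "c = VS 0 ! l"
  have c_deg: "2 \<le> hdegree T c"
    using pendant_path_hdegree[OF PP fin, of 0 "l - 1"] k l len[of 0] by (simp add: c_def)
  obtain att where root: "rooted_at T c att" and c: "c \<in> verts T"
    using root_ex[OF c_deg] by blast
  have c_edge: "E 0 ! (l - 1) \<in> hedges T" "c \<in> E 0 ! (l - 1)"
    using edge[of 0 "l - 1"] k l by (auto simp: c_def)
  \<comment> \<open>The last edge of path 0 contains \<open>c\<close>. If \<open>c\<close> were
    inner on path \<open>i\<close>, this edge would lie on that path too; disjointness leaves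
    \<open>i = 0\<close>, where \<open>c\<close> is the end and not inner.\<close>
  have c_inner: "VS i ! q \<noteq> c" if "i < k" "1 \<le> q" "q < l" for i q
  proof
    assume *: "VS i ! q = c"
    then have "E 0 ! (l - 1) \<in> set (E i)"
      using inner_edge[OF that c_edge(1)] c_edge(2) by simp
    then have "i = 0"
      using E_same[of "E 0 ! (l - 1)" i 0] E_nth[of 0 "l - 1"] k l that by auto
    then show False
      using * VS_eq[of 0 q l] that by (simp add: c_def)
  qed
  have att_E: "att (E i ! q) = VS i ! Suc q" if "i < k" "q < l" for i q
    using pendant_path_towards_root[OF root fin c_deg sub PP[OF that(1)], of q] c_inner that len
    by auto
  have att_in: "att f \<in> f" if "f \<in> hedges T" for f
    using root that by (simp add: rooted_at_def)
  define own where "own f = f - {att f}" for f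
  have own_card: "finite (own f)" "card (own f) = r - 1" if "f \<in> hedges T" for f
    using edge_card[OF that] att_in[OF that] by (auto simp: own_def)
  have own_unique: "f = g" if "f \<in> hedges T" "g \<in> hedges T" "x \<in> own f" "x \<in> own g" for f g x
  proof -
    have "x \<noteq> c" "x \<in> verts T"
      using that root sub by (auto simp: own_def rooted_at_def)
    then have "\<exists>!f. f \<in> hedges T \<and> x \<in> f \<and> x \<noteq> att f"
      using root by (simp add: rooted_at_def)
    then show ?thesis
      using that unfolding own_def by blast
  qed
  have own_cover: "verts T = insert c (\<Union>f\<in>hedges T. own f)"
  proof
    show "verts T \<subseteq> insert c (\<Union>f\<in>hedges T. own f)"
    proof
      fix x assume "x \<in> verts T"
      then have "x = c \<or> (\<exists>!f. f \<in> hedges T \<and> x \<in> f \<and> x \<noteq> att f)"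
        using root by (auto simp: rooted_at_def)
      then show "x \<in> insert c (\<Union>f\<in>hedges T. own f)"
        unfolding own_def by blast
    qed
  qed (use c sub in \<open>auto simp: own_def\<close>)
  have c_own: "c \<notin> own f" if "f \<in> hedges T" for f
    using root that by (auto simp: rooted_at_def own_def)
  define legs where "legs = (\<Union>i<k. set (E i))"
  have legs_sub: "legs \<subseteq> hedges T"
    using E_sub by (auto simp: legs_def)
  have E_dist: "distinct (E i)" if "i < k" for i
    using PP[OF that] by (simp add: pendant_path_def loose_path_def)
  have "card legs = (\<Sum>i<k. card (set (E i)))"
    unfolding legs_def using E_disj by (intro card_UN_disjoint) auto
  also have "\<dots> = k * l"
    using E_dist len by (simp add: distinct_card)
  finally have "card (hedges T - legs) = card {k..<k + (m - k * l)}"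
    using legs_sub fin m by (simp add: card_Diff_subset finite_subset)
  then obtain R where R: "bij_betw R {k..<k + (m - k * l)} (hedges T - legs)"
    using finite_same_card_bij[of "{k..<k + (m - k * l)}" "hedges T - legs"] fin by auto
  \<comment> \<open>Pendant paths are listed from the free end but branches of \<open>S\<close> from
    the centre, hence the reversed index \<open>l - j\<close>. The edges on no leg are numbered by
    \<open>R\<close>.\<close>
  define ed where "ed = (\<lambda>(b, j). if b < k then E b ! (l - j) else R b)"
  have ed_leg: "ed (b, j) = E b ! (l - j)" if "b < k" for b j
    using that by (simp add: ed_def)
  have ed_rest: "ed (b, j) \<in> hedges T \<and> ed (b, j) \<notin> legs" if "k \<le> b" "b < k + (m - k * l)" for b j
    using that bij_betwE[OF R] by (auto simp: ed_def)
  have ed_edge: "ed (b, j) \<in> hedges T" if "(b, j) \<in> S_index l m k" for b j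
    using that edge(1)[of b "l - j"] ed_rest[of b j] by (auto simp: S_index_iff ed_leg)
  have ed_inj: "b = b' \<and> j = j'"
    if "(b, j) \<in> S_index l m k" "(b', j') \<in> S_index l m k" "ed (b, j) = ed (b', j')" for b j b' j'
  proof -
    have in_legs: "ed (b, j) \<in> set (E b)" "ed (b, j) \<in> legs" if "(b, j) \<in> S_index l m k" "b < k" for b j
      using that E_nth[of b "l - j"] by (auto simp: ed_leg legs_def S_index_iff)
    have same_type: "b < k \<longleftrightarrow> b' < k"
      using in_legs(2)[OF that(1)] in_legs(2)[OF that(2)] ed_rest[of b j] ed_rest[of b' j'] that
      by (auto simp: S_index_iff)
    show ?thesis
    proof (cases "b < k")
      case True
      then have "b = b'"
        using E_same[of "ed (b, j)" b b'] in_legs(1)[OF that(1)] in_legs(1)[OF that(2)] same_type that(3)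
        by auto
      moreover have "E b ! (l - j) = E b ! (l - j')"
        using that(3) True \<open>b = b'\<close> by (simp add: ed_leg)
      then have "l - j = l - j'"
        using pendant_path_edge_eq_iff[OF PP[OF True] fin, of "l - j" "l - j'"] that True \<open>b = b'\<close> len[of b]
        by (auto simp: S_index_iff)
      ultimately show ?thesis
        using that True by (auto simp: S_index_iff)
    next
      case False
      then have "R b = R b'" "b \<in> {k..<k + (m - k * l)}" "b' \<in> {k..<k + (m - k * l)}" "j = j'"
        using that same_type by (auto simp: S_index_iff ed_def)
      then show ?thesis
        using R by (auto simp: bij_betw_def dest: inj_onD)
    qed
  qed
  have ed_surj: "\<exists>b j. (b, j) \<in> S_index l m k \<and> ed (b, j) = f" if f: "f \<in> hedges T" for f
  proof (cases "f \<in> legs")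
    case True
    then obtain b q where bq: "b < k" "q < l" "f = E b ! q"
      using len by (auto simp: legs_def in_set_conv_nth)
    then have "(b, l - q) \<in> S_index l m k" "ed (b, l - q) = f"
      by (auto simp: S_index_iff ed_leg)
    then show ?thesis
      by blast
  next
    case False
    then have "f \<in> R ` {k..<k + (m - k * l)}"
      using R f by (simp add: bij_betw_def)
    then obtain b where "b \<in> {k..<k + (m - k * l)}" "f = R b"
      by blast
    then have "(b, 1) \<in> S_index l m k" "ed (b, 1) = f"
      by (auto simp: S_index_iff ed_def)
    then show ?thesis
      by blast
  qed
  have hedges_eq: "hedges T = ed ` S_index l m k"
    using ed_surj ed_edge by force
  \<comment> \<open>In \<open>S\<close> the next edge of a leg grows at the vertex with index 1, so
    this index must go to \<open>VS b ! (l - j)\<close>. For the outermost edge of a leg and for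
    single-edge branches any vertex will do.\<close>
  have "\<exists>h. bij_betw h {1..r - 1} (own (ed (b, j))) \<and> (b < k \<and> j < l \<longrightarrow> h 1 = VS b ! (l - j))"
    if bj: "(b, j) \<in> S_index l m k" for b j
  proof -
    have fc: "finite (own (ed (b, j)))" "card (own (ed (b, j))) = r - 1"
      using own_card ed_edge[OF bj] by auto
    obtain a where "a \<in> own (ed (b, j))" "b < k \<and> j < l \<longrightarrow> a = VS b ! (l - j)"
    proof (cases "b < k \<and> j < l")
      case True
      then have "l - j < l"
        using bj by (auto simp: S_index_iff)
      then have "VS b ! (l - j) \<in> own (ed (b, j))"
        using True edge(2)[of b "l - j"] att_E[of b "l - j"] VS_eq[of b "l - j" "Suc (l - j)"]
        by (auto simp: own_def ed_leg)
      then show ?thesis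
        using that by blast
    next
      case False
      have "own (ed (b, j)) \<noteq> {}"
        using fc r by auto
      then show ?thesis
        using that False by blast
    qed
    then show ?thesis
      using ex_bij_betw_pointed[OF fc] by metis
  qed
  then have "\<forall>bj. \<exists>h. bj \<in> S_index l m k \<longrightarrow> bij_betw h {1..r - 1} (own (ed bj)) \<and>
      (fst bj < k \<and> snd bj < l \<longrightarrow> h 1 = VS (fst bj) ! (l - snd bj))"
    by auto
  then obtain g where "\<And>bj. bj \<in> S_index l m k \<Longrightarrow> bij_betw (g bj) {1..r - 1} (own (ed bj)) \<and>
      (fst bj < k \<and> snd bj < l \<longrightarrow> g bj 1 = VS (fst bj) ! (l - snd bj))"
    by metis
  then have g: "bij_betw (g (b, j)) {1..r - 1} (own (ed (b, j)))"
    and g1: "b < k \<Longrightarrow> j < l \<Longrightarrow> g (b, j) 1 = VS b ! (l - j)"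
    if "(b, j) \<in> S_index l m k" for b j
    using that by force+
  define V where "V = verts (S_hypertree r l m k)"
  define \<phi> where "\<phi> = (\<lambda>(b, j, t). if j = 0 then c else g (b, j) t)"
  have \<phi>0: "\<phi> (0, 0, 0) = c"
    by (simp add: \<phi>_def)
  have \<phi>_own: "\<phi> ` S_own r b j = own (ed (b, j))" if bj: "(b, j) \<in> S_index l m k" for b j
  proof -
    have "j \<noteq> 0"
      using bj by (auto simp: S_index_iff)
    then have "\<phi> ` S_own r b j = g (b, j) ` {1..r - 1}"
      by (simp add: \<phi>_def S_own_def image_image)
    then show ?thesis
      using g[OF bj] by (simp add: bij_betw_def)
  qed
  have V_eq: "V = insert (0, 0, 0) (\<Union>(b, j)\<in>S_index l m k. S_own r b j)"
    by (simp add: V_def S_hypertree_def)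
  have "\<phi> ` V = insert c (\<Union>bj\<in>S_index l m k. \<phi> ` (case bj of (b, j) \<Rightarrow> S_own r b j))"
    unfolding V_eq image_insert image_UN \<phi>0 by (rule refl)
  also have "(\<Union>bj\<in>S_index l m k. \<phi> ` (case bj of (b, j) \<Rightarrow> S_own r b j)) =
      (\<Union>bj\<in>S_index l m k. own (ed bj))"
    using \<phi>_own by (intro SUP_cong) auto
  also have "insert c \<dots> = verts T"
    unfolding own_cover by (simp add: hedges_eq)
  finally have \<phi>_img: "\<phi> ` V = verts T" .
  have \<phi>_in_own: "\<phi> (b, j, t) \<in> own (ed (b, j))" if "(b, j) \<in> S_index l m k" "t \<in> {1..r - 1}" for b j t
    using \<phi>_own[OF that(1)] that(2) by (auto simp: S_own_def)
  have "inj_on \<phi> V"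
  proof (rule inj_onI)
    fix x y assume xy: "x \<in> V" "y \<in> V" "\<phi> x = \<phi> y"
    obtain b j t b' j' t' where eq: "x = (b, j, t)" "y = (b', j', t')"
      by (cases x, cases y) auto
    have x: "b = 0 \<and> j = 0 \<and> t = 0 \<or> (b, j) \<in> S_index l m k \<and> t \<in> {1..r - 1}"
      and y: "b' = 0 \<and> j' = 0 \<and> t' = 0 \<or> (b', j') \<in> S_index l m k \<and> t' \<in> {1..r - 1}"
      using xy unfolding eq V_def S_verts_iff by auto
    have ne: "\<phi> (b, j, t) \<noteq> c" if "(b, j) \<in> S_index l m k" "t \<in> {1..r - 1}" for b j t
      using \<phi>_in_own[OF that] c_own[OF ed_edge[OF that(1)]] by auto
    show "x = y"
    proof (cases "(b, j) \<in> S_index l m k \<and> t \<in> {1..r - 1}")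
      case True
      then have T': "(b', j') \<in> S_index l m k" "t' \<in> {1..r - 1}"
        using y ne[of b j t] xy(3) \<phi>0 unfolding eq by auto
      have "ed (b, j) = ed (b', j')"
        using own_unique[OF ed_edge[of b j] ed_edge[of b' j'], of "\<phi> x"] \<phi>_in_own[of b j t]
          \<phi>_in_own[of b' j' t'] xy(3) True T' unfolding eq by auto
      then have bj: "b = b'" "j = j'"
        using ed_inj True T' by blast+
      have "j \<noteq> 0"
        using True by (auto simp: S_index_iff)
      then have "g (b, j) t = g (b, j) t'"
        using xy(3) bj by (simp add: eq \<phi>_def)
      then have "t = t'"
        using g[of b j] True T' by (auto simp: bij_betw_def dest: inj_onD)
      then show ?thesis
        using bj eq by simp
    next
      case False
      then have "\<phi> y = c" "x = (0, 0, 0)"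
        using x xy(3) \<phi>0 eq by auto
      then show ?thesis
        using y ne[of b' j' t'] eq by auto
    qed
  qed
  with \<phi>_img have \<phi>: "bij_betw \<phi> V (verts T)"
    by (simp add: bij_betw_def)
  define \<alpha> where "\<alpha> b = inv_into V \<phi> (att (ed (b, 1)))" for b
  have idx1: "(b, 1) \<in> S_index l m k" if "b < k + (m - k * l)" for b
    using that l by (auto simp: S_index_iff)
  have att_V: "att f \<in> verts T" if "f \<in> hedges T" for f
    using att_in[OF that] sub[OF that] by blast
  have \<alpha>: "\<alpha> b \<in> V" "\<phi> (\<alpha> b) = att (ed (b, 1))" if "b < k + (m - k * l)" for b
    using att_V[OF ed_edge[OF idx1[OF that]]] \<phi>_img unfolding \<alpha>_def
    by (auto intro: inv_into_into f_inv_into_f)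
  have "branches r l m k \<alpha>"
  proof
    have "att (ed (0, 1)) = c"
      using att_E[of 0 "l - 1"] k l by (simp add: ed_leg c_def)
    then show "\<alpha> 0 = (0, 0, 0)"
      using inv_into_f_f[OF \<open>inj_on \<phi> V\<close>, of "(0, 0, 0)"] \<phi>0 by (simp add: \<alpha>_def V_eq)
    fix b assume b: "b < k + (m - k * l)"
    obtain b' j' t' where eq: "\<alpha> b = (b', j', t')"
      by (cases "\<alpha> b") auto
    show "\<alpha> b \<in> S_core r l m k"
    proof (cases "k \<le> b' \<or> (b', j', t') = (0, 0, 0)")
      case True
      then show ?thesis
        using \<alpha>(1)[OF b] k unfolding eq V_def S_verts_iff by (auto simp: S_core_def S_index_iff)
    next
      case False
      then have b'k: "b' < k" and idx: "(b', j') \<in> S_index l m k" "t' \<in> {1..r - 1}"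
        using \<alpha>(1)[OF b] unfolding eq V_def S_verts_iff by auto
      \<comment> \<open>Suppose branch \<open>b\<close> hangs at a vertex \<open>x\<close> owned by
        an edge of leg \<open>b'\<close>. Having degree at least 2 and not being the
        \<open>att\<close> of that edge, \<open>x\<close> is an inner vertex of leg
        \<open>b'\<close>, and all its edges lie on that leg. Then \<open>b = b'\<close>, so
        \<open>x\<close> is also the end of the leg, which is impossible.\<close>
      define q where "q = l - j'"
      have q: "q < l"
        using idx b'k by (auto simp: S_index_iff q_def)
      define f where "f = ed (b, 1)"
      define x where "x = att f"
      have f: "f \<in> hedges T" "x \<in> f"
        unfolding x_def f_def using ed_edge[OF idx1[OF b]] att_in by auto
      have "x \<in> own (E b' ! q)"
        using \<phi>_in_own[OF idx] \<alpha>(2)[OF b] by (simp add: eq x_def f_def ed_leg[OF b'k] q_def)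
      then have x: "x \<in> E b' ! q" "x \<noteq> VS b' ! Suc q"
        using att_E[OF b'k q] by (auto simp: own_def)
      have "2 \<le> hdegree T x"
        unfolding x_def using rooted_att_hdegree[OF root fin c_deg f(1)] sub f(1) by blast
      then have xq: "x = VS b' ! q" "1 \<le> q"
        using pendant_path_branch_vertex[OF PP[OF b'k] fin, of q x] x q len[OF b'k] by auto
      then have fE: "f \<in> set (E b')"
        using inner_edge[OF b'k _ q f(1)] f(2) by simp
      then have "f \<in> legs"
        using b'k by (auto simp: legs_def)
      then have bk: "b < k"
        using ed_rest[OF _ b, of 1] unfolding f_def by (meson not_less)
      then have "f = E b ! (l - 1)"
        by (simp add: f_def ed_leg)
      moreover have "b = b'"
        using E_same[of f b b'] E_nth[of b "l - 1"] fE bk b'k l \<open>f = E b ! (l - 1)\<close> by auto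
      ultimately have "x = VS b' ! l"
        using att_E[of b "l - 1"] bk l by (simp add: x_def)
      then show ?thesis
        using xq VS_eq[of b' q l] b'k q by auto
    qed
  qed (use r l k in auto)
  moreover have "hiso (branch_hypergraph r l m k \<alpha>) T"
    unfolding hiso_def
  proof (intro exI[of _ \<phi>] conjI)
    show "bij_betw \<phi> (verts (branch_hypergraph r l m k \<alpha>)) (verts T)"
      using \<phi> by (simp add: branch_hypergraph_def V_def)
    have "\<phi> ` insert (attach \<alpha> b j) (S_own r b j) = ed (b, j)" if bj: "(b, j) \<in> S_index l m k" for b j
    proof -
      have "\<phi> (attach \<alpha> b j) = att (ed (b, j))"
      proof (cases "j = 1")
        case True
        then show ?thesis
          using \<alpha>(2)[of b] bj by (auto simp: attach_def S_index_iff)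
      next
        case False
        then have b: "b < k" "2 \<le> j" "j \<le> l" and prev: "(b, j - 1) \<in> S_index l m k"
          using bj by (auto simp: S_index_iff)
        then have "\<phi> (attach \<alpha> b j) = VS b ! (l - (j - 1))"
          using g1[OF prev] by (simp add: attach_def \<phi>_def)
        moreover have "l - (j - 1) = Suc (l - j)"
          using b by simp
        ultimately show ?thesis
          using att_E[of b "l - j"] b by (simp add: ed_leg)
      qed
      then show ?thesis
        using \<phi>_own[OF bj] att_in[OF ed_edge[OF bj]] by (auto simp: own_def)
    qed
    then have "(\<lambda>bj. \<phi> ` (case bj of (b, j) \<Rightarrow> insert (attach \<alpha> b j) (S_own r b j))) ` S_index l m k =
        ed ` S_index l m k"
      by (intro image_cong) (auto simp del: image_insert)
    then show "hedges T = (\<lambda>e. \<phi> ` e) ` hedges (branch_hypergraph r l m k \<alpha>)"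
      unfolding hedges_eq by (simp add: branch_hypergraph_def image_image)
  qed
  ultimately show ?thesis
    using that by blast
qed

theorem theorem1p2:
  fixes r m k l :: nat and T :: "'a hypergraph"
  assumes "r \<ge> 3"
    and "(k = 1 \<and> 2 \<le> l \<and> l + 2 \<le> m) \<or> (k \<ge> 2 \<and> l \<ge> 2 \<and> k * l + 1 \<le> m)"
    and "power_hypertree r T"
    and "card (hedges T) = m"
    and "card (pendant_paths T l) = k"
  shows "distance_spectral_radius T \<ge> distance_spectral_radius (S_hypertree r l m k) \<and>
    (distance_spectral_radius T = distance_spectral_radius (S_hypertree r l m k) \<longleftrightarrow>
      hiso T (S_hypertree r l m k))"
proof -
  have "k \<ge> 1" "l \<ge> 1" "k * l \<le> m"
    using assms(2) by auto
  \<comment> \<open>This bound prevents distinct pendant paths of length \<open>l\<close> from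
    overlapping; for \<open>k = 1\<close> there is no second path.\<close>
  moreover have "2 * l \<le> m" if "k \<ge> 2"
    using assms(2) mult_le_mono1[OF that, of l] that by linarith
  ultimately obtain \<alpha> where \<alpha>: "branches r l m k \<alpha>" and iso: "hiso (branch_hypergraph r l m k \<alpha>) T"
    using power_hypertree_normal_form[of r l k T m] assms by metis
  interpret br: branches r l m k \<alpha>
    by (rule \<alpha>)
  note sub = power_hypertree_rooted(3)[OF assms(3)]
  have subT: "e \<subseteq> verts T" if "e \<in> hedges T" for e
    using sub[OF _ that] assms(1) by simp
  have conn: "hconnected (branch_hypergraph r l m k \<alpha>)"
    using hiso_hconnected[OF hiso_sym[OF iso br.edge_subset] subT] power_hypertree_rooted(5)[OF assms(3)] assms(1)
    by simp
  have rho: "distance_spectral_radius T = distance_spectral_radius (branch_hypergraph r l m k \<alpha>)"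
    using hiso_distance_spectral_radius[OF iso br.edge_subset] by simp
  have iso_eq: "distance_spectral_radius T = distance_spectral_radius (S_hypertree r l m k)"
    if "hiso T (S_hypertree r l m k)"
    using hiso_distance_spectral_radius[OF that subT] .
  show ?thesis
  \<comment> \<open>A branch hung off the centre makes the inequality strict, which also excludes an
    isomorphism with \<open>S\<close>, since isomorphic hypergraphs have equal radii. Otherwise the
    normal form is \<open>S\<close> itself.\<close>
  proof (cases "\<exists>b<k + (m - k * l). \<alpha> b \<noteq> (0, 0, 0)")
    case True
    then have "distance_spectral_radius (S_hypertree r l m k) < distance_spectral_radius T"
      using br.S_spectral_radius_less[OF conn] rho by auto
    then show ?thesis
      using iso_eq by auto
  next
    case False
    then have "branch_hypergraph r l m k \<alpha> = S_hypertree r l m k"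
      by (intro S_hypertree_eq_branch_hypergraph) auto
    then have "hiso T (S_hypertree r l m k)"
      using hiso_sym[OF iso br.edge_subset] by simp
    then show ?thesis
      using iso_eq by simp
  qed
qed

end
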